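(* Let $\tilde I\in\mathbb R^{d\times d}$ be a (symmetric) positive definite preconditioning matrix and let the target distribution be $\bar\pi=N_d(0,J^{-1})$, where $J\in\mathbb R^{d\times d}$ is symmetric positive definite with $\tilde I^{1/2}J\tilde I^{1/2}=\mathrm{diag}(\rho_2,\rho_2,\dots,\rho_2,\rho_1)$. Assume $1\le\kappa=\rho_2/\rho_1\le c_1d^{c_2}$ for some $c_1,c_2>0$. Then there exist an integer $N$ depending only on $c_1,c_2$ and universal constants $c_3,c_4>0$ such that for any $d>N$, $M_0\ge2$, step size $h>0$ and tolerance $\varepsilon\in(0,1)$, the $\tfrac12$-lazy version of preconditioned MALA for sampling from $\bar\pi$ satisfies $$\tau_{\rm mix}(\varepsilon,M_0)\ \ge\ c_3\,\kappa\Big(\frac{d}{\log(d\kappa)}\Big)^{1/3}\log\Big(\frac{c_4}{\varepsilon}\Big).$$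
   Context: Preconditioned MALA for $\bar\pi=N_d(0,J^{-1})$ with step size $h$: let $Q(x,\cdot)$ be the density of $N_d(x-h\tilde IJx,2h\tilde I)$ and $A(x,y)=\min\{1,\frac{\bar\pi(y)Q(y,x)}{\bar\pi(x)Q(x,y)}\}$. Its $\zeta$-lazy version (here $\zeta=\tfrac12$) is the Markov chain with kernel $T^\zeta(x,dy)=(1-(1-\zeta)\int A(x,y)Q(x,y)dy)\delta_x(dy)+(1-\zeta)A(x,y)Q(x,y)dy$. A distribution $\mu_0$ is $M_0$-warm with respect to $\bar\pi$ if $\mu_0(E)\le M_0\bar\pi(E)$ for all Borel $E\subset\mathbb R^d$. With $\mu_k$ the law of the chain after $k$ steps from $\mu_0$, $\tau_{\rm mix}(\varepsilon,\mu_0)=\inf\{k\in\mathbb N:\sqrt{\chi^2(\mu_k,\bar\pi)}\le\varepsilon\}$ and $\tau_{\rm mix}(\varepsilon,M_0)$ is the maximum of $\tau_{\rm mix}(\varepsilon,\mu_0)$ over all $M_0$-warm starts $\mu_0$ with respect to $\bar\pi$. *)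

theory Defs
  imports
    "HOL-Probability.Probability"
    "Jordan_Normal_Form.Determinant"
    "Jordan_Normal_Form.Gauss_Jordan_Elimination"
begin

(* The dimension d is an ordinary natural number that is quantified inside the theorem, so matrices
   are those of Jordan_Normal_Form, while points of R^d are extensional functions on {..<d}, for
   which the product measure PiM provides the Borel sets and Lebesgue measure.  A point x is
   passed to the matrix operations as the vector  Matrix.vec d x. *)

abbreviation lebesgue_Rn :: "nat \<Rightarrow> (nat \<Rightarrow> real) measure" where
  "lebesgue_Rn d \<equiv> PiM {..<d} (\<lambda>_. lborel)"

definition spd_mat :: "nat \<Rightarrow> real mat \<Rightarrow> bool" where
  "spd_mat d A \<longleftrightarrow> A \<in> carrier_mat d d \<and> transpose_mat A = A \<and>
     (\<forall>v \<in> carrier_vec d. v \<noteq> 0\<^sub>v d \<longrightarrow> scalar_prod v (A *\<^sub>v v) > 0)"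

definition spd_sqrt :: "nat \<Rightarrow> real mat \<Rightarrow> real mat \<Rightarrow> bool" where
  "spd_sqrt d A S \<longleftrightarrow> spd_mat d S \<and> S * S = A"

definition inverse_mat :: "real mat \<Rightarrow> real mat" where
  "inverse_mat A = the (mat_inverse A)"

(* m is the mean, C the covariance matrix *)
definition gauss_density :: "nat \<Rightarrow> real Matrix.vec \<Rightarrow> real mat \<Rightarrow> (nat \<Rightarrow> real) \<Rightarrow> real" where
  "gauss_density d m C y =
     (let z = Matrix.vec d y - m
      in exp (- (1 / 2) * scalar_prod z (inverse_mat C *\<^sub>v z)) /
         sqrt ((2 * pi) ^ d * Determinant.det C))"

definition target_density :: "nat \<Rightarrow> real mat \<Rightarrow> (nat \<Rightarrow> real) \<Rightarrow> real" where
  "target_density d J = gauss_density d (0\<^sub>v d) (inverse_mat J)"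

definition target :: "nat \<Rightarrow> real mat \<Rightarrow> (nat \<Rightarrow> real) measure" where
  "target d J = density (lebesgue_Rn d) (\<lambda>x. ennreal (target_density d J x))"

(* In the following, I is the preconditioner and Q x y the density at y of the proposal from x. *)
definition mala_proposal ::
    "nat \<Rightarrow> real mat \<Rightarrow> real mat \<Rightarrow> real \<Rightarrow> (nat \<Rightarrow> real) \<Rightarrow> (nat \<Rightarrow> real) \<Rightarrow> real" where
  "mala_proposal d I J h x =
     gauss_density d (Matrix.vec d x - h \<cdot>\<^sub>v (I *\<^sub>v (J *\<^sub>v Matrix.vec d x))) ((2 * h) \<cdot>\<^sub>m I)"

definition mala_accept ::
    "nat \<Rightarrow> real mat \<Rightarrow> real mat \<Rightarrow> real \<Rightarrow> (nat \<Rightarrow> real) \<Rightarrow> (nat \<Rightarrow> real) \<Rightarrow> real" where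
  "mala_accept d I J h x y =
     min 1 ((target_density d J y * mala_proposal d I J h y x) /
            (target_density d J x * mala_proposal d I J h x y))"

definition lazy_mala_kernel ::
    "real \<Rightarrow> nat \<Rightarrow> real mat \<Rightarrow> real mat \<Rightarrow> real \<Rightarrow> (nat \<Rightarrow> real) \<Rightarrow> (nat \<Rightarrow> real) measure" where
  "lazy_mala_kernel \<zeta> d I J h x =
     measure_of (space (lebesgue_Rn d)) (sets (lebesgue_Rn d))
       (\<lambda>E. ennreal (1 - (1 - \<zeta>) *
               (\<integral>y. mala_accept d I J h x y * mala_proposal d I J h x y \<partial>lebesgue_Rn d))
               * indicator E x
          + ennreal (1 - \<zeta>) *
               (\<integral>\<^sup>+y\<in>E. ennreal (mala_accept d I J h x y * mala_proposal d I J h x y)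
                  \<partial>lebesgue_Rn d))"

definition lazy_mala_law ::
    "real \<Rightarrow> nat \<Rightarrow> real mat \<Rightarrow> real mat \<Rightarrow> real \<Rightarrow> (nat \<Rightarrow> real) measure \<Rightarrow> nat
       \<Rightarrow> (nat \<Rightarrow> real) measure" where
  "lazy_mala_law \<zeta> d I J h \<mu> k =
     ((\<lambda>\<nu>. Giry_Monad.bind \<nu> (lazy_mala_kernel \<zeta> d I J h)) ^^ k) \<mu>"

definition chi_square :: "'a measure \<Rightarrow> 'a measure \<Rightarrow> ennreal" where
  "chi_square \<mu> \<pi> =
     (if absolutely_continuous \<pi> \<mu>
      then \<integral>\<^sup>+x. ennreal ((enn2real (RN_deriv \<pi> \<mu> x) - 1)\<^sup>2) \<partial>\<pi>
      else \<infinity>)"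

definition ennsqrt :: "ennreal \<Rightarrow> ennreal" where
  "ennsqrt x = (if x = \<infinity> then \<infinity> else ennreal (sqrt (enn2real x)))"

definition warm_start :: "real \<Rightarrow> 'a measure \<Rightarrow> 'a measure \<Rightarrow> bool" where
  "warm_start M\<^sub>0 \<pi> \<mu> \<longleftrightarrow> prob_space \<mu> \<and> sets \<mu> = sets \<pi> \<and>
     (\<forall>E \<in> sets \<pi>. emeasure \<mu> E \<le> ennreal M\<^sub>0 * emeasure \<pi> E)"

(* Extended naturals: the value is infinity if the tolerance is never reached. *)
definition mix_time_from ::
    "real \<Rightarrow> nat \<Rightarrow> real mat \<Rightarrow> real mat \<Rightarrow> real \<Rightarrow> real \<Rightarrow> (nat \<Rightarrow> real) measure \<Rightarrow> enat" where
  "mix_time_from \<zeta> d I J h \<epsilon> \<mu> =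
     (INF k \<in> {k. ennsqrt (chi_square (lazy_mala_law \<zeta> d I J h \<mu> k) (target d J)) \<le> ennreal \<epsilon>}.
        enat k)"

definition mix_time ::
    "real \<Rightarrow> nat \<Rightarrow> real mat \<Rightarrow> real mat \<Rightarrow> real \<Rightarrow> real \<Rightarrow> real \<Rightarrow> enat" where
  "mix_time \<zeta> d I J h \<epsilon> M\<^sub>0 =
     (SUP \<mu> \<in> {\<mu>. warm_start M\<^sub>0 (target d J) \<mu>}. mix_time_from \<zeta> d I J h \<epsilon> \<mu>)"

end

theory Submission
  imports Defs
begin

text \<open>
  The chain is reversible, so for the start with density \<open>1 + g\<close> and \<open>\<integral> g d\<pi> = 0\<close> the law after \<open>k\<close> steps
  has density \<open>1 + P\<^sup>k g\<close>, and \<open>\<parallel>P\<^sup>k g\<parallel>\<close> is log-convex in \<open>k\<close>. Hence the chi-square distance decays no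
  faster than the Dirichlet form of the single test function \<open>g\<close> allows, without any spectral theory.
  Take for \<open>g\<close> the slow coordinate (curvature \<open>\<rho>\<^sub>1\<close>), truncated at \<open>\<plusminus>1\<close>. Put \<open>s = h \<rho>\<^sub>2\<close>. Dropping the rejections,
  the Dirichlet form is at most of order \<open>s / \<kappa>\<close>. Since \<open>min(a, b) \<le> \<surd>(a b)\<close>, it is also at most the
  affinity of the two joint densities in the detailed balance ratio, which is a product of two-dimensional
  Gaussian integrals: each of the \<open>d - 1\<close> fast coordinates contributes exactly \<open>(1 + s\<^sup>3 / 8)\<^sup>-\<^sup>1\<^sup>/\<^sup>2\<close>.
  The two bounds cross near \<open>s\<^sup>3 = ln (d \<kappa>) / d\<close>.
\<close>

section \<open>Linear change of variables for Lebesgue measure\<close>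

text \<open>The obstacle is that the square root \<open>S\<close> of the preconditioner mixes all
  coordinates. In the variable u with x = S u the target has precision \<open>S * J * S\<close>, the
  drift is diagonal and the noise isotropic, so target and proposal are products over the same
  coordinates; only the acceptance couples them. Both bounds on the Dirichlet form remove this
  coupling: one drops the acceptance, the other uses that a geometric mean of product densities is
  again a product. In the determinant of each planar Gaussian integral the terms of order s^2
  cancel, which leaves s^3 and hence the exponent 1/3. Truncation keeps the density 1 + g between 0
  and 2, so warmth 2 suffices. Let V be the variance of the truncated coordinate and t = (ln (d
  \<kappa>) / d)^(1/3). The chi-square distance of the start is V, whence \<open>c\<^sub>4\<close>
  is its square root; the Dirichlet quotient is at most G = 6 t / (V \<kappa>), and a decay rate of
  at most 2 G per step gives V / 12 for \<open>c\<^sub>3\<close>. The choice of N makes t \<le> V /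
  12, so that G \<le> 1 / 2, where ln (1 - G) is at least - 2 G.\<close>

definition affine_map :: "nat \<Rightarrow> real mat \<Rightarrow> (nat \<Rightarrow> real) \<Rightarrow> (nat \<Rightarrow> real) \<Rightarrow> nat \<Rightarrow> real" where
  "affine_map n A v x = (\<lambda>i\<in>{..<n}. (\<Sum>j<n. A $$ (i, j) * x j) + v i)"

lemma measurable_affine_map [measurable]:
  "affine_map n A v \<in> lebesgue_Rn n \<rightarrow>\<^sub>M lebesgue_Rn n"
  unfolding affine_map_def by measurable

lemma scalar_prod_sum: "dim_vec w = n \<Longrightarrow> scalar_prod v w = (\<Sum>i<n. vec_index v i * vec_index w i)"
  by (simp add: scalar_prod_def atLeast0LessThan)

lemma mult_mat_vec_sum:
  "A \<in> carrier_mat n n \<Longrightarrow> i < n \<Longrightarrow> dim_vec w = n \<Longrightarrow>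
     vec_index (A *\<^sub>v w) i = (\<Sum>j<n. A $$ (i, j) * vec_index w j)"
  by (simp add: scalar_prod_def atLeast0LessThan)

section \<open>Elimination of the last coordinate\<close>

lemma spd_mat_det_nonzero:
  assumes "spd_mat n A"
  shows "Determinant.det A \<noteq> 0"
proof
  have A: "A \<in> carrier_mat n n" using assms by (simp add: spd_mat_def)
  assume "Determinant.det A = 0"
  then obtain v where v: "v \<in> carrier_vec n" "v \<noteq> 0\<^sub>v n" "A *\<^sub>v v = 0\<^sub>v n"
    using det_0_iff_vec_prod_zero[OF A] by auto
  have "scalar_prod v (A *\<^sub>v v) > 0"
    using assms v by (auto simp: spd_mat_def)
  then show False using v by simp
qed

text \<open>Padding a vector with a last entry 0 makes the quadratic form of the block a value of
  that of \<open>A\<close>. Positive definiteness is a property that the induction on the dimension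
  can carry: every leading block is again invertible, so elimination proceeds without row
  exchanges.\<close>

lemma spd_mat_leading_block:
  assumes "spd_mat (Suc n) A"
  shows "spd_mat n (Matrix.mat n n (\<lambda>ij. A $$ ij))" (is "spd_mat n ?B")
proof -
  have A: "A \<in> carrier_mat (Suc n) (Suc n)" and sym: "transpose_mat A = A"
    using assms by (auto simp: spd_mat_def)
  have "transpose_mat ?B = ?B"
  proof (rule eq_matI)
    fix i j assume "i < dim_row ?B" "j < dim_col ?B"
    then show "transpose_mat ?B $$ (i, j) = ?B $$ (i, j)"
      using A arg_cong[OF sym, of "\<lambda>M. M $$ (i, j)"] by simp
  qed auto
  moreover have "scalar_prod v (?B *\<^sub>v v) > 0" if v: "v \<in> carrier_vec n" "v \<noteq> 0\<^sub>v n" for v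
  proof -
    define w where "w = Matrix.vec (Suc n) (\<lambda>i. if i < n then vec_index v i else 0)"
    have w: "w \<in> carrier_vec (Suc n)" by (simp add: w_def)
    have "w \<noteq> 0\<^sub>v (Suc n)"
    proof
      assume *: "w = 0\<^sub>v (Suc n)"
      have "v = 0\<^sub>v n"
      proof (rule eq_vecI)
        fix i assume "i < dim_vec (0\<^sub>v n :: real Matrix.vec)"
        then show "vec_index v i = vec_index (0\<^sub>v n) i"
          using arg_cong[OF *, of "\<lambda>u. vec_index u i"] by (simp add: w_def)
      qed (use v in auto)
      then show False using v by simp
    qed
    then have "scalar_prod w (A *\<^sub>v w) > 0" using assms w by (auto simp: spd_mat_def)
    also have "scalar_prod w (A *\<^sub>v w) = (\<Sum>i<Suc n. vec_index w i * (\<Sum>j<Suc n. A $$ (i, j) * vec_index w j))"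
      using A w by (subst scalar_prod_sum[of _ "Suc n"])
        (auto simp del: index_mult_mat_vec sum.lessThan_Suc simp: mult_mat_vec_sum[OF A] intro!: sum.cong)
    also have "\<dots> = (\<Sum>i<n. vec_index v i * (\<Sum>j<n. A $$ (i, j) * vec_index v j))"
      by (simp add: w_def)
    also have "\<dots> = scalar_prod v (?B *\<^sub>v v)"
      using v by (subst scalar_prod_sum[of _ n]) (auto simp del: index_mult_mat_vec simp: mult_mat_vec_sum[of _ n] intro!: sum.cong)
    finally show ?thesis .
  qed
  ultimately show ?thesis by (simp add: spd_mat_def)
qed

lemma exists_solution:
  assumes A: "(A :: real mat) \<in> carrier_mat n n" and det: "Determinant.det A \<noteq> 0"
  shows "\<exists>w. \<forall>i<n. (\<Sum>j<n. A $$ (i, j) * w j) = b i"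
proof -
  obtain B where B: "B \<in> carrier_mat n n" "A * B = 1\<^sub>m n"
    using det_non_zero_imp_unit[OF A det, of "()"] by (auto simp: Units_def ring_mat_def)
  let ?w = "B *\<^sub>v Matrix.vec n b"
  have "A *\<^sub>v ?w = Matrix.vec n b"
    using A B by (simp flip: assoc_mult_mat_vec[of _ n n _ n])
  then have "(\<Sum>j<n. A $$ (i, j) * vec_index ?w j) = b i" if "i < n" for i
    using mult_mat_vec_sum[OF A that, of ?w] B that by auto
  then show ?thesis by blast
qed

text \<open>The column operation \<open>U\<close> subtracts from the last column the combination
  \<open>w\<close> of the others. It has determinant 1 and leaves a block lower triangular matrix
  with the Schur complement in the corner.\<close>

lemma det_schur:
  assumes A: "(A :: real mat) \<in> carrier_mat (Suc n) (Suc n)"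
    and w: "\<And>i. i < n \<Longrightarrow> (\<Sum>j<n. A $$ (i, j) * w j) = A $$ (i, n)"
  shows "Determinant.det A =
    Determinant.det (Matrix.mat n n (\<lambda>ij. A $$ ij)) * (A $$ (n, n) - (\<Sum>j<n. A $$ (n, j) * w j))"
proof -
  let ?A' = "Matrix.mat n n (\<lambda>ij. A $$ ij)"
  let ?c = "A $$ (n, n) - (\<Sum>j<n. A $$ (n, j) * w j)"
  let ?r = "Matrix.mat 1 n (\<lambda>(i, j). A $$ (n, j))"
  define U where "U = Matrix.mat (Suc n) (Suc n) (\<lambda>(i, j). if i = j then 1 else if j = n then - w i else 0)"
  define R where "R = four_block_mat ?A' (0\<^sub>m n 1) ?r (Matrix.mat 1 1 (\<lambda>_. ?c))"
  have U: "U \<in> carrier_mat (Suc n) (Suc n)" by (simp add: U_def)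
  have "upper_triangular U" by (auto simp: U_def)
  moreover have "diag_mat U = replicate (Suc n) 1"
    by (rule nth_equalityI) (auto simp: U_def diag_mat_def simp del: upt_Suc replicate_Suc)
  ultimately have "Determinant.det U = 1"
    by (simp add: det_upper_triangular[OF _ U])
  moreover have "A * U = R"
  proof (rule eq_matI)
    fix i j assume "i < dim_row R" "j < dim_col R"
    then have i: "i < Suc n" and j: "j < Suc n" by (auto simp: R_def)
    have *: "(A * U) $$ (i, j) = (\<Sum>k<n. A $$ (i, k) * U $$ (k, j)) + A $$ (i, n) * U $$ (n, j)"
      using A U i j by (simp add: scalar_prod_def atLeast0LessThan)
    show "(A * U) $$ (i, j) = R $$ (i, j)"
    proof (cases "j = n")
      case True
      have "(A * U) $$ (i, j) = A $$ (i, n) - (\<Sum>k<n. A $$ (i, k) * w k)"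
        using * True by (simp add: U_def sum_negf)
      then show ?thesis using w i True by (cases "i = n") (auto simp: R_def)
    next
      case False
      have "(A * U) $$ (i, j) = A $$ (i, j)"
        unfolding * using False j by (simp add: U_def if_distrib[of "(*) _"] cong: if_cong)
      then show ?thesis using i j False by (cases "i = n") (auto simp: R_def)
    qed
  qed (use A U in \<open>auto simp: R_def\<close>)
  moreover have "Determinant.det R = Determinant.det ?A' * ?c"
    unfolding R_def by (subst det_four_block_mat_upper_right_zero_col[of _ n]) (auto simp: det_single)
  ultimately show ?thesis using det_mult[OF A U] by simp
qed

text \<open>By symmetry the first \<open>n\<close> entries of the last row of \<open>A\<close> are
  the combination \<open>w\<close> of the rows above. Hence the last output depends on
  \<open>x\<close> only through the first \<open>n\<close> outputs \<open>z\<close>, and for given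
  \<open>z\<close> it is affine in \<open>t\<close> with the Schur complement as slope.\<close>

lemma affine_map_upd:
  assumes A: "A \<in> carrier_mat (Suc n) (Suc n)" and sym: "transpose_mat A = A"
    and w: "\<And>i. i < n \<Longrightarrow> (\<Sum>j<n. A $$ (i, j) * w j) = A $$ (i, n)"
  defines "A' \<equiv> Matrix.mat n n (\<lambda>ij. A $$ ij)"
  assumes z: "z = affine_map n A' (\<lambda>i. A $$ (i, n) * t + v i) x"
  shows "affine_map (Suc n) A v (x(n := t)) =
    z(n := ((\<Sum>j<n. w j * (z j - v j)) + v n) + (A $$ (n, n) - (\<Sum>j<n. A $$ (n, j) * w j)) * t)"
proof -
  have s: "A $$ (i, j) = A $$ (j, i)" if "i < Suc n" "j < Suc n" for i j
    using A that arg_cong[OF sym, of "\<lambda>M. M $$ (i, j)"] by simp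
  have zj: "z j = (\<Sum>l<n. A $$ (j, l) * x l) + (A $$ (j, n) * t + v j)" if "j < n" for j
    using that by (simp add: z affine_map_def A'_def)
  have "(\<Sum>j<n. w j * (z j - v j)) = (\<Sum>j<n. w j * (\<Sum>l<n. A $$ (j, l) * x l)) + (\<Sum>j<n. w j * (A $$ (j, n) * t))"
    by (simp add: zj sum.distrib distrib_left)
  also have "(\<Sum>j<n. w j * (\<Sum>l<n. A $$ (j, l) * x l)) = (\<Sum>l<n. (\<Sum>j<n. A $$ (l, j) * w j) * x l)"
    unfolding sum_distrib_left sum_distrib_right
    by (subst sum.swap) (auto intro!: sum.cong simp: s)
  also have "\<dots> = (\<Sum>l<n. A $$ (n, l) * x l)"
    using w s by (intro sum.cong) auto
  also have "(\<Sum>j<n. w j * (A $$ (j, n) * t)) = (\<Sum>j<n. A $$ (n, j) * w j) * t"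
    unfolding sum_distrib_right using s by (intro sum.cong) auto
  finally have *: "(\<Sum>j<n. w j * (z j - v j)) = (\<Sum>l<n. A $$ (n, l) * x l) + (\<Sum>j<n. A $$ (n, j) * w j) * t" .
  show ?thesis
  proof
    fix i
    consider "i < n" | "i = n" | "i > n" by linarith
    then show "affine_map (Suc n) A v (x(n := t)) i = (z(n := ((\<Sum>j<n. w j * (z j - v j)) + v n) +
        (A $$ (n, n) - (\<Sum>j<n. A $$ (n, j) * w j)) * t)) i"
    proof cases
      case 1
      then show ?thesis using zj[of i] by (simp add: affine_map_def)
    next
      case 2
      then show ?thesis by (simp only: *) (simp add: affine_map_def algebra_simps)
    next
      case 3
      then show ?thesis by (simp add: affine_map_def z)
    qed
  qed
qed

interpretation lborel_prod: product_sigma_finite "\<lambda>_::nat. lborel :: real measure"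
  by standard

text \<open>The translation \<open>v\<close> is needed for the induction: once the last coordinate is fixed, the others
  undergo an affine map.\<close>

lemma nn_integral_affine_map:
  assumes "spd_mat n A" "f \<in> borel_measurable (lebesgue_Rn n)"
  shows "(\<integral>\<^sup>+x. f x \<partial>lebesgue_Rn n) =
    ennreal \<bar>Determinant.det A\<bar> * (\<integral>\<^sup>+x. f (affine_map n A v x) \<partial>lebesgue_Rn n)"
  using assms
proof (induction n arbitrary: A f v)
  case 0
  then have "A \<in> carrier_mat 0 0" by (simp add: spd_mat_def)
  then show ?case by (simp add: PiM_empty affine_map_def nn_integral_count_space_finite)
next
  case (Suc n)
  note [measurable] = Suc.prems(2)
  interpret Rn: sigma_finite_measure "lebesgue_Rn n"
    by (rule lborel_prod.sigma_finite) simp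
  let ?A' = "Matrix.mat n n (\<lambda>ij. A $$ ij)"
  have A: "A \<in> carrier_mat (Suc n) (Suc n)" and sym: "transpose_mat A = A"
    using Suc.prems by (auto simp: spd_mat_def)
  have A': "spd_mat n ?A'" by (rule spd_mat_leading_block) fact
  obtain w where w: "\<And>i. i < n \<Longrightarrow> (\<Sum>j<n. A $$ (i, j) * w j) = A $$ (i, n)"
    using exists_solution[of ?A' n "\<lambda>i. A $$ (i, n)"] spd_mat_det_nonzero[OF A'] by auto
  define c where "c = A $$ (n, n) - (\<Sum>j<n. A $$ (n, j) * w j)"
  have det: "Determinant.det A = Determinant.det ?A' * c"
    unfolding c_def by (rule det_schur[OF A w])
  have c: "c \<noteq> 0" using det spd_mat_det_nonzero[OF Suc.prems(1)] by auto
  define \<alpha> where "\<alpha> z = (\<Sum>j<n. w j * (z j - v j)) + v n" for z :: "nat \<Rightarrow> real"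
  have [measurable]: "\<alpha> \<in> borel_measurable (lebesgue_Rn n)"
    unfolding \<alpha>_def by measurable
  have eq: "lebesgue_Rn (Suc n) = PiM (insert n {..<n}) (\<lambda>_. lborel)"
    by (simp add: lessThan_Suc)
  have [measurable]: "f \<in> borel_measurable (PiM (insert n {..<n}) (\<lambda>_. lborel))"
    using Suc.prems(2) by (simp only: eq)
  define F where "F x = f (affine_map (Suc n) A v x)" for x
  have "F \<in> borel_measurable (lebesgue_Rn (Suc n))"
    unfolding F_def by measurable
  then have [measurable]: "F \<in> borel_measurable (PiM (insert n {..<n}) (\<lambda>_. lborel))"
    by (simp only: eq)
  have "(\<integral>\<^sup>+x. f x \<partial>lebesgue_Rn (Suc n)) = (\<integral>\<^sup>+z. (\<integral>\<^sup>+t. f (z(n := t)) \<partial>lborel) \<partial>lebesgue_Rn n)"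
    unfolding eq by (rule lborel_prod.product_nn_integral_insert) auto
  \<comment> \<open>With \<open>z\<close> fixed, an affine substitution in the last variable alone;
    its factor is the Schur complement. Exchanging the integrals then makes room for the
    substitution in \<open>z\<close> at fixed \<open>t\<close>.\<close>
  also have "\<dots> = (\<integral>\<^sup>+z. ennreal \<bar>c\<bar> * (\<integral>\<^sup>+t. f (z(n := \<alpha> z + c * t)) \<partial>lborel) \<partial>lebesgue_Rn n)"
    by (intro nn_integral_cong nn_integral_real_affine c) measurable
  also have "\<dots> = ennreal \<bar>c\<bar> * (\<integral>\<^sup>+z. (\<integral>\<^sup>+t. f (z(n := \<alpha> z + c * t)) \<partial>lborel) \<partial>lebesgue_Rn n)"
    by (rule nn_integral_cmult) measurable
  also have "(\<integral>\<^sup>+z. (\<integral>\<^sup>+t. f (z(n := \<alpha> z + c * t)) \<partial>lborel) \<partial>lebesgue_Rn n) =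
      (\<integral>\<^sup>+t. (\<integral>\<^sup>+z. f (z(n := \<alpha> z + c * t)) \<partial>lebesgue_Rn n) \<partial>lborel)"
    by (rule pair_sigma_finite.Fubini')
      (auto intro!: pair_sigma_finite.intro lborel_prod.sigma_finite lborel.sigma_finite_measure_axioms)
  also have "\<dots> = (\<integral>\<^sup>+t. ennreal \<bar>Determinant.det ?A'\<bar> *
      (\<integral>\<^sup>+x. F (x(n := t)) \<partial>lebesgue_Rn n) \<partial>lborel)"
  proof (intro nn_integral_cong)
    fix t :: real
    have [measurable]: "(\<lambda>z. f (z(n := \<alpha> z + c * t))) \<in> borel_measurable (lebesgue_Rn n)"
      by measurable
    \<comment> \<open>The induction hypothesis is taken with the translation that column
      \<open>n\<close> of \<open>A\<close> contributes at this \<open>t\<close>;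
      \<open>affine_map_upd\<close> then recognizes \<open>F (x(n := t))\<close>.\<close>
    have "(\<integral>\<^sup>+z. f (z(n := \<alpha> z + c * t)) \<partial>lebesgue_Rn n) = ennreal \<bar>Determinant.det ?A'\<bar> *
       (\<integral>\<^sup>+x. f ((affine_map n ?A' (\<lambda>i. A $$ (i, n) * t + v i) x)
          (n := \<alpha> (affine_map n ?A' (\<lambda>i. A $$ (i, n) * t + v i) x) + c * t)) \<partial>lebesgue_Rn n)"
      by (rule Suc.IH[OF A']) measurable
    then show "(\<integral>\<^sup>+z. f (z(n := \<alpha> z + c * t)) \<partial>lebesgue_Rn n) = ennreal \<bar>Determinant.det ?A'\<bar> *
      (\<integral>\<^sup>+x. F (x(n := t)) \<partial>lebesgue_Rn n)"
      unfolding \<alpha>_def c_def F_def by (simp add: affine_map_upd[OF A sym w refl])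
  qed
  also have "\<dots> = ennreal \<bar>Determinant.det ?A'\<bar> *
      (\<integral>\<^sup>+t. (\<integral>\<^sup>+x. F (x(n := t)) \<partial>lebesgue_Rn n) \<partial>lborel)"
    by (intro nn_integral_cmult) measurable
  also have "(\<integral>\<^sup>+t. (\<integral>\<^sup>+x. F (x(n := t)) \<partial>lebesgue_Rn n) \<partial>lborel) =
      (\<integral>\<^sup>+x. F x \<partial>lebesgue_Rn (Suc n))"
    unfolding eq by (intro lborel_prod.product_nn_integral_insert_rev[symmetric]) auto
  finally show ?case
    by (simp add: F_def det abs_mult ennreal_mult mult_ac)
qed

section \<open>Reversible Metropolis chains\<close>

text \<open>Strict positivity of both densities makes the acceptance ratio a genuine quotient at
  every pair of points. Nothing Gaussian enters here: dimension and conditioning are felt only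
  through bounds on the Dirichlet form.\<close>

locale metropolis = sigma_finite_measure M
  for M :: "'a measure" and p :: "'a \<Rightarrow> real" and q :: "'a \<Rightarrow> 'a \<Rightarrow> real" and \<zeta> :: real +
  assumes p_pos: "x \<in> space M \<Longrightarrow> 0 < p x"
    and q_pos: "x \<in> space M \<Longrightarrow> y \<in> space M \<Longrightarrow> 0 < q x y"
    and p_measurable [measurable]: "p \<in> borel_measurable M"
    and q_measurable [measurable]: "case_prod q \<in> borel_measurable (M \<Otimes>\<^sub>M M)"
    and nn_integral_p: "(\<integral>\<^sup>+x. ennreal (p x) \<partial>M) = 1"
    and nn_integral_q: "x \<in> space M \<Longrightarrow> (\<integral>\<^sup>+y. ennreal (q x y) \<partial>M) = 1"
    and \<zeta>: "0 \<le> \<zeta>" "\<zeta> \<le> 1"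
begin

sublocale pair: pair_sigma_finite M M ..

definition accept :: "'a \<Rightarrow> 'a \<Rightarrow> real" where
  "accept x y = min 1 ((p y * q y x) / (p x * q x y))"

definition r :: "'a \<Rightarrow> 'a \<Rightarrow> real" where
  "r x y = accept x y * q x y"

definition a :: "'a \<Rightarrow> real" where
  "a x = (\<integral>y. r x y \<partial>M)"

definition kernel :: "'a \<Rightarrow> 'a measure" where
  "kernel x = measure_of (space M) (sets M)
     (\<lambda>E. ennreal (1 - (1 - \<zeta>) * a x) * indicator E x
        + ennreal (1 - \<zeta>) * (\<integral>\<^sup>+y\<in>E. ennreal (r x y) \<partial>M))"

text \<open>Bounded functions take the place of L2: \<open>P\<close> is given by a plain integral at
  every point, preserves the bound \<open>C\<close>, and all integrals below converge. The bound is
  demanded everywhere and not almost everywhere, so that \<open>1 + f x\<close> is nonnegative at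
  each point when \<open>C\<close> is 1.\<close>

definition bounded_by :: "real \<Rightarrow> ('a \<Rightarrow> real) \<Rightarrow> bool" where
  "bounded_by C f \<longleftrightarrow> f \<in> borel_measurable M \<and> (\<forall>x\<in>space M. \<bar>f x\<bar> \<le> C)"

definition P :: "('a \<Rightarrow> real) \<Rightarrow> 'a \<Rightarrow> real" where
  "P f x = (1 - (1 - \<zeta>) * a x) * f x + (1 - \<zeta>) * (\<integral>y. r x y * f y \<partial>M)"

definition ip :: "('a \<Rightarrow> real) \<Rightarrow> ('a \<Rightarrow> real) \<Rightarrow> real" where
  "ip f g = (\<integral>x. p x * (f x * g x) \<partial>M)"

lemma accept_bounds: "x \<in> space M \<Longrightarrow> y \<in> space M \<Longrightarrow> 0 \<le> accept x y \<and> accept x y \<le> 1"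
  using p_pos q_pos by (auto simp: accept_def less_imp_le)

lemma r_bounds: "x \<in> space M \<Longrightarrow> y \<in> space M \<Longrightarrow> 0 \<le> r x y \<and> r x y \<le> q x y"
  using accept_bounds[of x y] q_pos[of x y] by (auto simp: r_def mult_left_le_one_le)

text \<open>Clearing the denominator leaves a form symmetric under exchange of \<open>x\<close> and
  \<open>y\<close>. It yields detailed balance at once and later the bound by a geometric
  mean.\<close>

lemma p_r_eq_min:
  assumes "x \<in> space M" "y \<in> space M"
  shows "p x * r x y = min (p x * q x y) (p y * q y x)"
proof -
  have pos: "p x * q x y > 0" using assms p_pos q_pos by simp
  have "p x * r x y = min 1 ((p y * q y x) / (p x * q x y)) * (p x * q x y)"
    by (simp add: r_def accept_def)
  also have "\<dots> = min (p x * q x y) (p y * q y x)"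
    using pos p_pos[OF assms(1)] q_pos[OF assms] by (simp add: min_mult_distrib_right)
  finally show ?thesis .
qed

lemma reversible: "x \<in> space M \<Longrightarrow> y \<in> space M \<Longrightarrow> p x * r x y = p y * r y x"
  by (simp add: p_r_eq_min min.commute)

lemma r_measurable_pair: "case_prod r \<in> borel_measurable (M \<Otimes>\<^sub>M M)"
  unfolding r_def accept_def by measurable

lemma r_measurable [measurable (raw)]:
  assumes [measurable]: "f \<in> N \<rightarrow>\<^sub>M M" "g \<in> N \<rightarrow>\<^sub>M M"
  shows "(\<lambda>x. r (f x) (g x)) \<in> borel_measurable N"
proof -
  have "(\<lambda>x. case_prod r (f x, g x)) \<in> borel_measurable N"
    by (rule measurable_compose[OF _ r_measurable_pair]) measurable
  then show ?thesis by simp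
qed

lemma integrable_p: "integrable M p"
  using nn_integral_p p_pos by (intro integrableI_nonneg) (auto simp: less_imp_le intro!: AE_I2)

lemma integral_p: "(\<integral>x. p x \<partial>M) = 1"
  using nn_integral_p p_pos by (subst integral_eq_nn_integral) (auto simp: less_imp_le intro!: AE_I2)

lemma q_measurable_snd [measurable]: "x \<in> space M \<Longrightarrow> q x \<in> borel_measurable M"
  using measurable_compose[OF measurable_Pair1'[of x M M] q_measurable] by simp

lemma integrable_q: "x \<in> space M \<Longrightarrow> integrable M (q x)"
  using nn_integral_q[of x] q_pos[of x]
  by (intro integrableI_nonneg) (auto simp: less_imp_le intro!: AE_I2)

lemma integral_q: "x \<in> space M \<Longrightarrow> (\<integral>y. q x y \<partial>M) = 1"
  using nn_integral_q[of x] q_pos[of x]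
  by (subst integral_eq_nn_integral) (auto simp: less_imp_le intro!: AE_I2)

lemma integrable_r: "x \<in> space M \<Longrightarrow> integrable M (r x)"
  by (rule Bochner_Integration.integrable_bound[OF integrable_q[of x]])
    (use r_bounds[of x] in \<open>auto intro!: AE_I2 order.trans[OF _ abs_ge_self]\<close>)

lemma a_bounds: "x \<in> space M \<Longrightarrow> 0 \<le> a x \<and> a x \<le> 1"
  unfolding a_def
  using integral_mono[OF integrable_r[of x] integrable_q[of x]] r_bounds[of x]
  by (auto simp: integral_q intro!: Bochner_Integration.integral_nonneg)

lemma hold_nonneg: "x \<in> space M \<Longrightarrow> 0 \<le> 1 - (1 - \<zeta>) * a x"
  using a_bounds[of x] \<zeta> mult_mono[of "1 - \<zeta>" 1 "a x" 1] by auto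

lemma a_measurable [measurable]: "a \<in> borel_measurable M"
  unfolding a_def by measurable

lemma bounded_by_measurable: "bounded_by C f \<Longrightarrow> f \<in> borel_measurable M"
  by (simp add: bounded_by_def)

text \<open>Dominated by \<open>C\<close> times the joint density of point and proposal, which has
  mass 1. This licenses the splitting of double integrals below.\<close>

lemma bounded_by_pair_integrable:
  assumes [measurable]: "F \<in> borel_measurable (M \<Otimes>\<^sub>M M)"
    and F: "\<And>x y. x \<in> space M \<Longrightarrow> y \<in> space M \<Longrightarrow> \<bar>F (x, y)\<bar> \<le> C"
  shows "integrable (M \<Otimes>\<^sub>M M) (\<lambda>z. p (fst z) * r (fst z) (snd z) * F z)"
proof -
  have "(\<integral>\<^sup>+z. ennreal (p (fst z) * q (fst z) (snd z)) \<partial>(M \<Otimes>\<^sub>M M)) =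
      (\<integral>\<^sup>+x. \<integral>\<^sup>+y. ennreal (p x * q x y) \<partial>M \<partial>M)"
    using nn_integral_fst[of "\<lambda>z. ennreal (p (fst z) * q (fst z) (snd z))" M] by simp
  also have "\<dots> = (\<integral>\<^sup>+x. ennreal (p x) * (\<integral>\<^sup>+y. ennreal (q x y) \<partial>M) \<partial>M)"
  proof (intro nn_integral_cong)
    fix x assume "x \<in> space M"
    then show "(\<integral>\<^sup>+y. ennreal (p x * q x y) \<partial>M) = ennreal (p x) * (\<integral>\<^sup>+y. ennreal (q x y) \<partial>M)"
      using p_pos[of x] q_pos[of x]
      by (subst nn_integral_cmult[symmetric]) (auto simp: less_imp_le ennreal_mult intro!: nn_integral_cong)
  qed
  also have "\<dots> = (\<integral>\<^sup>+x. ennreal (p x) \<partial>M)"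
    by (intro nn_integral_cong) (simp add: nn_integral_q)
  also have "\<dots> = 1" by (rule nn_integral_p)
  finally have "integrable (M \<Otimes>\<^sub>M M) (\<lambda>z. p (fst z) * q (fst z) (snd z))"
    using p_pos q_pos by (intro integrableI_nonneg)
      (auto simp: space_pair_measure less_imp_le intro!: AE_I2)
  then have "integrable (M \<Otimes>\<^sub>M M) (\<lambda>z. C * (p (fst z) * q (fst z) (snd z)))"
    by (rule integrable_mult_right)
  then show ?thesis
  proof (rule Bochner_Integration.integrable_bound)
    show "AE z in M \<Otimes>\<^sub>M M. norm (p (fst z) * r (fst z) (snd z) * F z) \<le>
        norm (C * (p (fst z) * q (fst z) (snd z)))"
    proof (rule AE_I2)
      fix z assume "z \<in> space (M \<Otimes>\<^sub>M M)"
      then obtain x y where z: "z = (x, y)" and xy: "x \<in> space M" "y \<in> space M"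
        by (auto simp: space_pair_measure)
      have "\<bar>p x * r x y * F (x, y)\<bar> = p x * r x y * \<bar>F (x, y)\<bar>"
        using p_pos[OF xy(1)] r_bounds[OF xy] by (simp add: abs_mult)
      also have "\<dots> \<le> p x * q x y * C"
        using p_pos[OF xy(1)] r_bounds[OF xy] F[OF xy] q_pos[OF xy]
        by (intro mult_mono) (auto intro: mult_left_mono)
      finally show "norm (p (fst z) * r (fst z) (snd z) * F z) \<le>
          norm (C * (p (fst z) * q (fst z) (snd z)))"
        by (simp add: z mult_ac)
    qed
  qed measurable
qed

section \<open>The Markov operator on bounded functions and its inner product\<close>

lemma integrable_r_bounded:
  assumes x: "x \<in> space M" and f: "bounded_by C f"
  shows "integrable M (\<lambda>y. r x y * f y)"
proof (rule Bochner_Integration.integrable_bound[OF integrable_mult_right[OF integrable_r[OF x], of C]])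
  show "(\<lambda>y. r x y * f y) \<in> borel_measurable M"
    using x bounded_by_measurable[OF f] by measurable
  show "AE y in M. norm (r x y * f y) \<le> norm (C * r x y)"
  proof (rule AE_I2)
    fix y assume y: "y \<in> space M"
    have "\<bar>r x y * f y\<bar> \<le> r x y * C"
      using r_bounds[OF x y] f y by (auto simp: bounded_by_def abs_mult intro: mult_left_mono)
    then show "norm (r x y * f y) \<le> norm (C * r x y)" by (simp add: mult.commute)
  qed
qed

lemma integral_r_bounded:
  assumes x: "x \<in> space M" and f: "bounded_by C f"
  shows "\<bar>\<integral>y. r x y * f y \<partial>M\<bar> \<le> C * a x"
proof -
  have "\<bar>\<integral>y. r x y * f y \<partial>M\<bar> \<le> (\<integral>y. \<bar>r x y * f y\<bar> \<partial>M)"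
    using integral_norm_bound[of M "\<lambda>y. r x y * f y"] by simp
  also have "\<dots> \<le> (\<integral>y. C * r x y \<partial>M)"
  proof (rule integral_mono)
    show "integrable M (\<lambda>y. \<bar>r x y * f y\<bar>)"
      by (rule integrable_abs[OF integrable_r_bounded[OF x f]])
    show "integrable M (\<lambda>y. C * r x y)" using integrable_r[OF x] by simp
    show "\<bar>r x y * f y\<bar> \<le> C * r x y" if y: "y \<in> space M" for y
      using r_bounds[OF x y] f y
      by (auto simp: bounded_by_def abs_mult mult.commute[of C] intro: mult_left_mono)
  qed
  finally show ?thesis by (simp add: a_def)
qed

text \<open>\<open>P f x\<close> is an average of values of \<open>f\<close>: the weight
  \<open>1 - (1 - \<zeta>) * a x\<close> of staying and the weight
  \<open>(1 - \<zeta>) * a x\<close> of moving add up to 1.\<close>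

lemma bounded_by_P:
  assumes f: "bounded_by C f"
  shows "bounded_by C (P f)"
proof -
  note [measurable] = bounded_by_measurable[OF f]
  have "\<bar>P f x\<bar> \<le> C" if x: "x \<in> space M" for x
  proof -
    have "\<bar>P f x\<bar> \<le> (1 - (1 - \<zeta>) * a x) * \<bar>f x\<bar> + (1 - \<zeta>) * \<bar>\<integral>y. r x y * f y \<partial>M\<bar>"
      unfolding P_def using hold_nonneg[OF x] \<zeta> by (intro order.trans[OF abs_triangle_ineq]) (simp add: abs_mult)
    also have "\<dots> \<le> (1 - (1 - \<zeta>) * a x) * C + (1 - \<zeta>) * (C * a x)"
      using hold_nonneg[OF x] \<zeta> f x integral_r_bounded[OF x f]
      by (intro add_mono mult_left_mono) (auto simp: bounded_by_def)
    also have "\<dots> = C" by (simp add: algebra_simps)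
    finally show ?thesis .
  qed
  moreover have "P f \<in> borel_measurable M"
    unfolding P_def by measurable
  ultimately show ?thesis by (simp add: bounded_by_def)
qed

lemma bounded_by_P_iterate: "bounded_by C f \<Longrightarrow> bounded_by C ((P ^^ k) f)"
  by (induction k) (auto intro: bounded_by_P)

lemma P_one_plus:
  assumes "bounded_by C f" "x \<in> space M"
  shows "P (\<lambda>x. 1 + f x) x = 1 + P f x"
proof -
  have "(\<integral>y. r x y * (1 + f y) \<partial>M) = a x + (\<integral>y. r x y * f y \<partial>M)"
    using integrable_r integrable_r_bounded assms
    by (simp add: distrib_left a_def)
  then show ?thesis by (simp add: P_def algebra_simps)
qed

lemma integrable_p_bounded:
  assumes "bounded_by C f"
  shows "integrable M (\<lambda>x. p x * f x)"
proof (rule Bochner_Integration.integrable_bound[OF integrable_mult_right[OF integrable_p, of C]])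
  show "(\<lambda>x. p x * f x) \<in> borel_measurable M"
    using bounded_by_measurable[OF assms] by measurable
  show "AE x in M. norm (p x * f x) \<le> norm (C * p x)"
    using p_pos assms by (intro AE_I2)
      (auto simp: bounded_by_def abs_mult mult.commute[of C] less_imp_le intro!: mult_left_mono order.trans[OF _ abs_ge_self])
qed

lemma bounded_by_mult:
  assumes "bounded_by C f" "bounded_by D g"
  shows "bounded_by (C * D) (\<lambda>x. f x * g x)"
  using assms by (auto simp: bounded_by_def abs_mult intro!: mult_mono')

lemma integrable_ip:
  assumes "bounded_by C f" "bounded_by D g"
  shows "integrable M (\<lambda>x. p x * (f x * g x))"
  by (rule integrable_p_bounded[OF bounded_by_mult[OF assms]])

lemma ip_commute: "ip f g = ip g f"
  by (simp add: ip_def mult.commute)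

lemma ip_nonneg: "0 \<le> ip f f"
  unfolding ip_def using p_pos by (intro Bochner_Integration.integral_nonneg) (auto simp: less_imp_le)

lemma ip_cauchy_schwarz:
  assumes f: "bounded_by C f" and g: "bounded_by D g"
  shows "(ip f g)\<^sup>2 \<le> ip f f * ip g g"
proof -
  have *: "0 \<le> ip f f - 2 * t * ip f g + t\<^sup>2 * ip g g" for t
  proof -
    have "0 \<le> ip (\<lambda>x. f x - t * g x) (\<lambda>x. f x - t * g x)" by (rule ip_nonneg)
    also have "\<dots> = (\<integral>x. p x * (f x * f x) - 2 * t * (p x * (f x * g x)) + t\<^sup>2 * (p x * (g x * g x)) \<partial>M)"
      unfolding ip_def by (rule Bochner_Integration.integral_cong) (auto simp: algebra_simps power2_eq_square)
    also have "\<dots> = ip f f - 2 * t * ip f g + t\<^sup>2 * ip g g"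
      using integrable_ip[OF f f] integrable_ip[OF f g] integrable_ip[OF g g] by (simp add: ip_def)
    finally show ?thesis .
  qed
  show ?thesis
  proof (cases "ip g g = 0")
    case True
    have "ip f g = 0"
    proof (rule ccontr)
      assume "ip f g \<noteq> 0"
      \<comment> \<open>For \<open>ip g g = 0\<close> the quadratic is linear in t, and this t gives
        it the value -1.\<close>
      then show False using *[of "(ip f f + 1) / (2 * ip f g)"] True by simp
    qed
    then show ?thesis using True by simp
  next
    case False
    then have "ip g g > 0" using ip_nonneg[of g] by simp
    then show ?thesis using *[of "ip f g / ip g g"]
      by (simp add: field_simps power2_eq_square)
  qed
qed

section \<open>Double integrals over accepted moves and the Dirichlet form\<close>

definition pair_form :: "('a \<times> 'a \<Rightarrow> real) \<Rightarrow> real" where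
  "pair_form F = (\<integral>z. p (fst z) * r (fst z) (snd z) * F z \<partial>(M \<Otimes>\<^sub>M M))"

text \<open>Detailed balance in integrated form: the flow \<open>p x * r x y\<close> of accepted
  moves is a symmetric measure.\<close>

lemma pair_form_swap:
  assumes "F \<in> borel_measurable (M \<Otimes>\<^sub>M M)"
  shows "pair_form (\<lambda>z. F (snd z, fst z)) = pair_form F"
proof -
  have "pair_form F = (\<integral>z. p (snd z) * r (snd z) (fst z) * F (snd z, fst z) \<partial>(M \<Otimes>\<^sub>M M))"
    unfolding pair_form_def using assms
    by (subst pair.integral_product_swap[symmetric]) (auto simp: case_prod_unfold)
  also have "\<dots> = pair_form (\<lambda>z. F (snd z, fst z))"
    unfolding pair_form_def
    by (rule Bochner_Integration.integral_cong) (auto simp: space_pair_measure reversible)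
  finally show ?thesis by simp
qed

lemma pair_form_prod:
  assumes f: "bounded_by C f" and g: "bounded_by D g"
  shows "pair_form (\<lambda>z. f (fst z) * g (snd z)) = (\<integral>x. p x * (f x * (\<integral>y. r x y * g y \<partial>M)) \<partial>M)"
proof -
  note [measurable] = bounded_by_measurable[OF f] bounded_by_measurable[OF g]
  have "integrable (M \<Otimes>\<^sub>M M) (\<lambda>z. p (fst z) * r (fst z) (snd z) * (f (fst z) * g (snd z)))"
    using f g by (intro bounded_by_pair_integrable[where C = "C * D"])
      (auto simp: bounded_by_def abs_mult intro!: mult_mono')
  then have "pair_form (\<lambda>z. f (fst z) * g (snd z)) = (\<integral>x. \<integral>y. p x * r x y * (f x * g y) \<partial>M \<partial>M)"
    unfolding pair_form_def by (subst pair.integral_fst'[symmetric]) auto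
  also have "\<dots> = (\<integral>x. p x * (f x * (\<integral>y. r x y * g y \<partial>M)) \<partial>M)"
  proof (rule Bochner_Integration.integral_cong)
    fix x
    have "(\<integral>y. p x * r x y * (f x * g y) \<partial>M) = (\<integral>y. (p x * f x) * (r x y * g y) \<partial>M)"
      by (simp add: mult_ac)
    also have "\<dots> = (p x * f x) * (\<integral>y. r x y * g y \<partial>M)"
      by (rule integral_mult_right_zero)
    finally show "(\<integral>y. p x * r x y * (f x * g y) \<partial>M) = p x * (f x * (\<integral>y. r x y * g y \<partial>M))"
      by simp
  qed simp
  finally show ?thesis .
qed

lemma bounded_by_const: "bounded_by \<bar>c\<bar> (\<lambda>_. c)"
  by (simp add: bounded_by_def)

text \<open>The acceptance probability \<open>a x\<close> is itself the integral of
  \<open>r x y\<close> over \<open>y\<close>, so the holding part also becomes a double integral. In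
  this form the first two terms are symmetric in \<open>f\<close> and \<open>g\<close> at sight, and
  the last one by exchange of the two points.\<close>

lemma ip_P:
  assumes f: "bounded_by C f" and g: "bounded_by D g"
  shows "ip f (P g) = ip f g - (1 - \<zeta>) * pair_form (\<lambda>z. f (fst z) * g (fst z))
     + (1 - \<zeta>) * pair_form (\<lambda>z. f (fst z) * g (snd z))"
proof -
  note [measurable] = bounded_by_measurable[OF f] bounded_by_measurable[OF g]
  have a: "bounded_by 1 a" using a_bounds by (auto simp: bounded_by_def)
  have Rg: "bounded_by D (\<lambda>x. \<integral>y. r x y * g y \<partial>M)"
  proof -
    have "D * a x \<le> D" if "x \<in> space M" for x
    proof -
      have "0 \<le> D" using g that by (auto simp: bounded_by_def intro: order.trans[OF abs_ge_zero])
      then show ?thesis using a_bounds[OF that] by (simp add: mult_left_le)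
    qed
    then show ?thesis
      using integral_r_bounded[OF _ g] by (auto simp: bounded_by_def intro: order.trans)
  qed
  have 1: "pair_form (\<lambda>z. f (fst z) * g (fst z)) = (\<integral>x. p x * (f x * g x * a x) \<partial>M)"
    using pair_form_prod[OF bounded_by_mult[OF f g] bounded_by_const[of 1]] by (simp add: a_def)
  have "ip f (P g) = (\<integral>x. p x * (f x * g x) - (1 - \<zeta>) * (p x * (f x * g x * a x))
      + (1 - \<zeta>) * (p x * (f x * (\<integral>y. r x y * g y \<partial>M))) \<partial>M)"
    unfolding ip_def P_def by (rule Bochner_Integration.integral_cong) (auto simp: algebra_simps)
  also have "\<dots> = ip f g - (1 - \<zeta>) * pair_form (\<lambda>z. f (fst z) * g (fst z))
     + (1 - \<zeta>) * pair_form (\<lambda>z. f (fst z) * g (snd z))"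
    using integrable_ip[OF f g] integrable_ip[OF bounded_by_mult[OF f g] a] integrable_ip[OF f Rg]
    by (simp add: ip_def 1 pair_form_prod[OF f g])
  finally show ?thesis .
qed

lemma P_self_adjoint:
  assumes f: "bounded_by C f" and g: "bounded_by D g"
  shows "ip f (P g) = ip (P f) g"
proof -
  note [measurable] = bounded_by_measurable[OF f] bounded_by_measurable[OF g]
  have "pair_form (\<lambda>z. f (fst z) * g (snd z)) = pair_form (\<lambda>z. g (fst z) * f (snd z))"
    using pair_form_swap[of "\<lambda>z. f (fst z) * g (snd z)"] by (simp add: mult.commute)
  then show ?thesis
    by (simp add: ip_P[OF f g] ip_commute[of "P f"] ip_P[OF g f] ip_commute[of g f] mult.commute)
qed

text \<open>Expanding the square gives two diagonal terms, equal by symmetry of the flow, and the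
  cross term of \<open>ip_P\<close>. Only accepted moves remain on the right, so an estimate of
  these bounds the decay rate from above.\<close>

lemma dirichlet_form:
  assumes g: "bounded_by C g"
  shows "ip g g - ip g (P g) = (1 - \<zeta>) / 2 * pair_form (\<lambda>z. (g (fst z) - g (snd z))\<^sup>2)"
proof -
  note [measurable] = bounded_by_measurable[OF g]
  have int: "integrable (M \<Otimes>\<^sub>M M) (\<lambda>z. p (fst z) * r (fst z) (snd z) * (g (u z) * g (v z)))"
    if "u \<in> {fst, snd}" "v \<in> {fst, snd}" for u v
    using g that by (intro bounded_by_pair_integrable[where C = "C * C"])
      (auto simp: bounded_by_def abs_mult intro!: mult_mono')
  have "pair_form (\<lambda>z. (g (fst z) - g (snd z))\<^sup>2) =
    (\<integral>z. p (fst z) * r (fst z) (snd z) * (g (fst z) * g (fst z))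
      - 2 * (p (fst z) * r (fst z) (snd z) * (g (fst z) * g (snd z)))
      + p (fst z) * r (fst z) (snd z) * (g (snd z) * g (snd z)) \<partial>(M \<Otimes>\<^sub>M M))"
    unfolding pair_form_def
    by (rule Bochner_Integration.integral_cong) (auto simp: algebra_simps power2_eq_square)
  also have "\<dots> = pair_form (\<lambda>z. g (fst z) * g (fst z)) - 2 * pair_form (\<lambda>z. g (fst z) * g (snd z))
      + pair_form (\<lambda>z. g (snd z) * g (snd z))"
    using int by (simp add: pair_form_def)
  also have "pair_form (\<lambda>z. g (snd z) * g (snd z)) = pair_form (\<lambda>z. g (fst z) * g (fst z))"
    using pair_form_swap[of "\<lambda>z. g (fst z) * g (fst z)"] by simp
  finally have *: "pair_form (\<lambda>z. (g (fst z) - g (snd z))\<^sup>2) =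
      pair_form (\<lambda>z. g (fst z) * g (fst z)) - 2 * pair_form (\<lambda>z. g (fst z) * g (snd z))
      + pair_form (\<lambda>z. g (fst z) * g (fst z))" .
  show ?thesis unfolding * ip_P[OF g g] by (simp add: field_simps)
qed

text \<open>Self-adjointness and the Cauchy-Schwarz inequality make \<open>k \<mapsto> ip (P\<^sup>k g) (P\<^sup>k g)\<close>
  log-convex, so its first ratio bounds all later ones from below.\<close>

lemma ip_P_iterate_lower:
  assumes g: "bounded_by C g" and gap: "ip g g - ip g (P g) \<le> G * ip g g" and G: "G \<le> 1"
  shows "(1 - G) ^ (2 * k) * ip g g \<le> ip ((P ^^ k) g) ((P ^^ k) g)"
proof -
  define b where "b k = ip ((P ^^ k) g) ((P ^^ k) g)" for k
  have bd: "bounded_by C ((P ^^ k) g)" for k by (rule bounded_by_P_iterate[OF g])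
  have nonneg: "0 \<le> b k" for k unfolding b_def by (rule ip_nonneg)
  have ratio: "(1 - G)\<^sup>2 * b k \<le> b (Suc k)" for k
  proof (induction k)
    case 0
    \<comment> \<open>\<open>G \<le> 1\<close> makes \<open>1 - G\<close> nonnegative, so that the
      lower bound for \<open>ip g (P g)\<close> may be squared.\<close>
    have "((1 - G) * b 0)\<^sup>2 \<le> (ip g (P g))\<^sup>2"
      using gap G nonneg[of 0]
      by (intro power_mono mult_nonneg_nonneg) (auto simp: b_def algebra_simps)
    also have "\<dots> \<le> b 0 * b 1"
      using ip_cauchy_schwarz[OF bd[of 0] bd[of 1]] by (simp add: b_def)
    finally have "b 0 * ((1 - G)\<^sup>2 * b 0) \<le> b 0 * b 1" by (simp add: power2_eq_square mult_ac)
    then show ?case using nonneg[of 0] nonneg[of 1] by (cases "b 0 = 0") (auto simp: less_le)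
  next
    case (Suc k)
    \<comment> \<open>One application of \<open>P\<close> moves from the left factor to the right;
      Cauchy-Schwarz then gives the log-convexity.\<close>
    have "(b (Suc k))\<^sup>2 = (ip ((P ^^ k) g) ((P ^^ Suc (Suc k)) g))\<^sup>2"
      using P_self_adjoint[OF bd[of k] bd[of "Suc k"]] by (simp add: b_def)
    also have "\<dots> \<le> b k * b (Suc (Suc k))"
      unfolding b_def by (rule ip_cauchy_schwarz[OF bd bd])
    finally have *: "(b (Suc k))\<^sup>2 \<le> b k * b (Suc (Suc k))" .
    show ?case
    proof (cases "b (Suc k) = 0")
      case True
      then show ?thesis using nonneg by simp
    next
      case False
      then have pos: "b (Suc k) > 0" using nonneg[of "Suc k"] by simp
      have "b k * ((1 - G)\<^sup>2 * b (Suc k)) = ((1 - G)\<^sup>2 * b k) * b (Suc k)" by simp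
      also have "\<dots> \<le> b (Suc k) * b (Suc k)" using Suc pos by (intro mult_right_mono) auto
      also have "\<dots> \<le> b k * b (Suc (Suc k))" using * by (simp add: power2_eq_square)
      finally have "b k * ((1 - G)\<^sup>2 * b (Suc k)) \<le> b k * b (Suc (Suc k))" .
      moreover have "b k > 0" using * pos nonneg[of k] by (cases "b k = 0") auto
      ultimately show ?thesis by simp
    qed
  qed
  have "((1 - G)\<^sup>2) ^ k * b 0 \<le> b k"
  proof (induction k)
    case (Suc k)
    have "((1 - G)\<^sup>2) ^ Suc k * b 0 \<le> (1 - G)\<^sup>2 * b k"
      using Suc by (simp add: mult.assoc mult_left_mono)
    also have "\<dots> \<le> b (Suc k)" by (rule ratio)
    finally show ?case .
  qed simp
  then show ?thesis by (simp add: b_def power_mult)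
qed

section \<open>Laws of the chain as densities, chi-square distance and warmth\<close>

definition target :: "'a measure" where
  "target = density M (\<lambda>x. ennreal (p x))"

definition tilted :: "('a \<Rightarrow> real) \<Rightarrow> 'a measure" where
  "tilted f = density M (\<lambda>x. ennreal (p x * f x))"

lemma sets_kernel [simp]: "sets (kernel x) = sets M" and space_kernel [simp]: "space (kernel x) = space M"
  by (simp_all add: kernel_def)

text \<open>\<open>measure_of\<close> returns the prescribed set function only once countable
  additivity is known. It holds because the function is a sum of multiples of a point mass and of
  the measure with density \<open>r x\<close>.\<close>

lemma emeasure_kernel:
  assumes x: "x \<in> space M" and E: "E \<in> sets M"
  shows "emeasure (kernel x) E = ennreal (1 - (1 - \<zeta>) * a x) * indicator E x
        + ennreal (1 - \<zeta>) * (\<integral>\<^sup>+y\<in>E. ennreal (r x y) \<partial>M)"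
proof -
  note [measurable] = x
  have r: "(\<integral>\<^sup>+y\<in>E. ennreal (r x y) \<partial>M) = emeasure (density M (\<lambda>y. ennreal (r x y))) E"
    if "E \<in> sets M" for E
    using that by (subst emeasure_density) auto
  have ind: "indicator E x = emeasure (return M x) E" if "E \<in> sets M" for E
    using that by simp
  have "countably_additive (sets M) (\<lambda>E. ennreal (1 - (1 - \<zeta>) * a x) * indicator E x
        + ennreal (1 - \<zeta>) * (\<integral>\<^sup>+y\<in>E. ennreal (r x y) \<partial>M))"
  proof (rule countably_additiveI)
    fix F :: "nat \<Rightarrow> 'a set"
    assume F: "range F \<subseteq> sets M" "disjoint_family F" and U: "\<Union> (range F) \<in> sets M"
    have Fi: "F i \<in> sets M" for i using F by auto
    have "(\<Sum>i. ennreal (1 - (1 - \<zeta>) * a x) * emeasure (return M x) (F i)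
        + ennreal (1 - \<zeta>) * emeasure (density M (\<lambda>y. ennreal (r x y))) (F i)) =
       ennreal (1 - (1 - \<zeta>) * a x) * emeasure (return M x) (\<Union> (range F))
        + ennreal (1 - \<zeta>) * emeasure (density M (\<lambda>y. ennreal (r x y))) (\<Union> (range F))"
    proof -
      have "(\<Sum>i. emeasure N (F i)) = emeasure N (\<Union> (range F))" if "sets N = sets M" for N :: "'a measure"
        using F that by (intro suminf_emeasure) auto
      from this[of "return M x"] this[of "density M (\<lambda>y. ennreal (r x y))"] show ?thesis
        by (simp only: suminf_add[OF summableI summableI, symmetric] ennreal_suminf_cmult sets_return sets_density)
    qed
    then show "(\<Sum>i. ennreal (1 - (1 - \<zeta>) * a x) * indicator (F i) x
        + ennreal (1 - \<zeta>) * (\<integral>\<^sup>+y\<in>F i. ennreal (r x y) \<partial>M)) =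
       ennreal (1 - (1 - \<zeta>) * a x) * indicator (\<Union> (range F)) x
        + ennreal (1 - \<zeta>) * (\<integral>\<^sup>+y\<in>\<Union> (range F). ennreal (r x y) \<partial>M)"
      using Fi U by (simp only: r ind)
  qed
  then show ?thesis
    unfolding kernel_def using E
    by (intro emeasure_measure_of_sigma) (auto simp: positive_def sets.sigma_algebra_axioms)
qed

lemma kernel_measurable [measurable]: "kernel \<in> M \<rightarrow>\<^sub>M subprob_algebra M"
proof (rule measurable_subprob_algebra)
  fix x assume x: "x \<in> space M"
  have "(\<integral>\<^sup>+y. ennreal (r x y) \<partial>M) = ennreal (a x)"
    unfolding a_def using integrable_r[OF x] r_bounds[OF x] by (intro nn_integral_eq_integral) auto
  then have "emeasure (kernel x) (space M) = ennreal (1 - (1 - \<zeta>) * a x) + ennreal (1 - \<zeta>) * ennreal (a x)"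
    using x by (simp add: emeasure_kernel cong: nn_integral_cong)
  also have "\<dots> = ennreal (1 - (1 - \<zeta>) * a x + (1 - \<zeta>) * a x)"
    using hold_nonneg[OF x] a_bounds[OF x] \<zeta>
    by (subst ennreal_plus) (auto simp: ennreal_mult)
  also have "\<dots> = 1" by simp
  finally show "subprob_space (kernel x)"
    using x by (intro subprob_spaceI) auto
next
  fix E assume [measurable]: "E \<in> sets M"
  have "(\<lambda>x. ennreal (1 - (1 - \<zeta>) * a x) * indicator E x
        + ennreal (1 - \<zeta>) * (\<integral>\<^sup>+y\<in>E. ennreal (r x y) \<partial>M)) \<in> borel_measurable M"
    by measurable
  then show "(\<lambda>x. emeasure (kernel x) E) \<in> borel_measurable M"
    by (rule measurable_cong[THEN iffD1, rotated]) (simp add: emeasure_kernel)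
qed simp

lemma space_nonempty: "space M \<noteq> {}"
  using nn_integral_p by (auto simp: nn_integral_empty)

text \<open>The kernel pushes laws forward whereas \<open>P\<close> averages functions; detailed
  balance identifies the two actions on densities relative to the target, so that the iterates of
  \<open>P\<close> describe the laws of the chain.\<close>

lemma bind_tilted_kernel:
  assumes f: "bounded_by C f" and nonneg: "\<And>x. x \<in> space M \<Longrightarrow> 0 \<le> f x"
  shows "Giry_Monad.bind (tilted f) kernel = tilted (P f)"
proof (rule measure_eqI)
  note [measurable] = bounded_by_measurable[OF f] bounded_by_measurable[OF bounded_by_P[OF f]]
  have kernel': "kernel \<in> tilted f \<rightarrow>\<^sub>M subprob_algebra M"
    using kernel_measurable by (simp add: tilted_def cong: measurable_cong_sets)
  show "sets (Giry_Monad.bind (tilted f) kernel) = sets (tilted (P f))"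
    using space_nonempty by (subst sets_bind[of _ _ M]) (auto simp: tilted_def)
  fix E assume "E \<in> sets (Giry_Monad.bind (tilted f) kernel)"
  then have E [measurable]: "E \<in> sets M"
    using space_nonempty by (subst (asm) sets_bind[of _ _ M]) (auto simp: tilted_def)
  have "emeasure (Giry_Monad.bind (tilted f) kernel) E = (\<integral>\<^sup>+x. emeasure (kernel x) E \<partial>tilted f)"
    using space_nonempty by (intro emeasure_bind[OF _ kernel' E]) (simp add: tilted_def)
  also have "\<dots> = (\<integral>\<^sup>+x. ennreal (p x * f x) * emeasure (kernel x) E \<partial>M)"
    unfolding tilted_def by (intro nn_integral_density) measurable
  also have "\<dots> = (\<integral>\<^sup>+x. ennreal (p x * ((1 - (1 - \<zeta>) * a x) * f x)) * indicator E x +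
      ennreal (1 - \<zeta>) * (\<integral>\<^sup>+y. ennreal (p x * r x y * f x) * indicator E y \<partial>M) \<partial>M)"
  proof (intro nn_integral_cong)
    fix x assume x: "x \<in> space M"
    have "ennreal (p x * f x) * (\<integral>\<^sup>+y\<in>E. ennreal (r x y) \<partial>M) =
        (\<integral>\<^sup>+y. ennreal (p x * r x y * f x) * indicator E y \<partial>M)"
      using x p_pos[OF x] nonneg[OF x] r_bounds[OF x]
      by (subst nn_integral_cmult[symmetric])
        (auto simp: ennreal_mult' mult_ac less_imp_le split: split_indicator intro!: nn_integral_cong)
    moreover have "ennreal (p x * f x) * ennreal (1 - (1 - \<zeta>) * a x) = ennreal (p x * ((1 - (1 - \<zeta>) * a x) * f x))"
      using hold_nonneg[OF x] p_pos[OF x] nonneg[OF x] by (simp add: ennreal_mult[symmetric] mult_ac)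
    ultimately show "ennreal (p x * f x) * emeasure (kernel x) E =
      ennreal (p x * ((1 - (1 - \<zeta>) * a x) * f x)) * indicator E x +
      ennreal (1 - \<zeta>) * (\<integral>\<^sup>+y. ennreal (p x * r x y * f x) * indicator E y \<partial>M)"
      unfolding emeasure_kernel[OF x E] distrib_left by (simp add: mult.left_commute mult.assoc[symmetric])
  qed
  also have "\<dots> = (\<integral>\<^sup>+x. ennreal (p x * ((1 - (1 - \<zeta>) * a x) * f x)) * indicator E x \<partial>M) +
      ennreal (1 - \<zeta>) * (\<integral>\<^sup>+x. \<integral>\<^sup>+y. ennreal (p x * r x y * f x) * indicator E y \<partial>M \<partial>M)"
    by (simp add: nn_integral_add nn_integral_cmult)
  \<comment> \<open>The mass arriving at \<open>y\<close> is gathered by exchanging the integrals.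
    Reversibility then rewrites the flow into \<open>y\<close> as a flow out of \<open>y\<close>,
    which splits off the factor \<open>p y\<close>.\<close>
  also have "(\<integral>\<^sup>+x. \<integral>\<^sup>+y. ennreal (p x * r x y * f x) * indicator E y \<partial>M \<partial>M) =
      (\<integral>\<^sup>+y. \<integral>\<^sup>+x. ennreal (p x * r x y * f x) * indicator E y \<partial>M \<partial>M)"
    by (rule pair.Fubini'[symmetric]) measurable
  also have "\<dots> = (\<integral>\<^sup>+y. ennreal (p y * (\<integral>x. r y x * f x \<partial>M)) * indicator E y \<partial>M)"
  proof (intro nn_integral_cong)
    fix y assume y: "y \<in> space M"
    have "(\<integral>\<^sup>+x. ennreal (p x * r x y * f x) * indicator E y \<partial>M) =
        (\<integral>\<^sup>+x. ennreal (p y * (r y x * f x)) * indicator E y \<partial>M)"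
      by (intro nn_integral_cong) (simp only: reversible[OF _ y] mult.assoc)
    also have "\<dots> = (\<integral>\<^sup>+x. ennreal (p y * (r y x * f x)) \<partial>M) * indicator E y"
      using y by (intro nn_integral_multc) measurable
    also have "(\<integral>\<^sup>+x. ennreal (p y * (r y x * f x)) \<partial>M) = ennreal (\<integral>x. p y * (r y x * f x) \<partial>M)"
      using integrable_r_bounded[OF y f] p_pos[OF y] r_bounds[OF y] nonneg
      by (intro nn_integral_eq_integral) (auto simp: less_imp_le)
    finally show "(\<integral>\<^sup>+x. ennreal (p x * r x y * f x) * indicator E y \<partial>M) =
        ennreal (p y * (\<integral>x. r y x * f x \<partial>M)) * indicator E y" by simp
  qed
  also have "(\<integral>\<^sup>+x. ennreal (p x * ((1 - (1 - \<zeta>) * a x) * f x)) * indicator E x \<partial>M) +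
      ennreal (1 - \<zeta>) * (\<integral>\<^sup>+y. ennreal (p y * (\<integral>x. r y x * f x \<partial>M)) * indicator E y \<partial>M) =
      (\<integral>\<^sup>+x. ennreal (p x * ((1 - (1 - \<zeta>) * a x) * f x)) * indicator E x +
       ennreal (1 - \<zeta>) * (ennreal (p x * (\<integral>y. r x y * f y \<partial>M)) * indicator E x) \<partial>M)"
    by (simp add: nn_integral_add nn_integral_cmult)
  also have "\<dots> = (\<integral>\<^sup>+x. ennreal (p x * P f x) * indicator E x \<partial>M)"
  proof (intro nn_integral_cong)
    fix x assume x: "x \<in> space M"
    have R: "0 \<le> (\<integral>y. r x y * f y \<partial>M)"
      using r_bounds[OF x] nonneg by (intro Bochner_Integration.integral_nonneg) auto
    have "ennreal (p x * P f x) = ennreal (p x * ((1 - (1 - \<zeta>) * a x) * f x) + (1 - \<zeta>) * (p x * (\<integral>y. r x y * f y \<partial>M)))"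
      by (simp add: P_def algebra_simps)
    also have "\<dots> = ennreal (p x * ((1 - (1 - \<zeta>) * a x) * f x)) + ennreal (1 - \<zeta>) * ennreal (p x * (\<integral>y. r x y * f y \<partial>M))"
      using R \<zeta> p_pos[OF x] nonneg[OF x] hold_nonneg[OF x] by (subst ennreal_plus) (auto simp: ennreal_mult)
    finally show "ennreal (p x * ((1 - (1 - \<zeta>) * a x) * f x)) * indicator E x +
       ennreal (1 - \<zeta>) * (ennreal (p x * (\<integral>y. r x y * f y \<partial>M)) * indicator E x) =
       ennreal (p x * P f x) * indicator E x"
      by (simp add: distrib_right mult.assoc)
  qed
  also have "\<dots> = emeasure (tilted (P f)) E"
    unfolding tilted_def by (rule emeasure_density[symmetric]) measurable
  finally show "emeasure (Giry_Monad.bind (tilted f) kernel) E = emeasure (tilted (P f)) E" .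
qed

text \<open>\<open>P\<close> fixes the constant 1 and preserves the bound 1 of \<open>g\<close>, so
  \<open>1 + (P ^^ k) g x\<close> remains a nonnegative density at every step.\<close>

lemma law_tilted:
  assumes g: "bounded_by 1 g"
  shows "((\<lambda>\<nu>. Giry_Monad.bind \<nu> kernel) ^^ k) (tilted (\<lambda>x. 1 + g x)) = tilted (\<lambda>x. 1 + (P ^^ k) g x)"
proof (induction k)
  case (Suc k)
  have bd: "bounded_by 1 ((P ^^ k) g)" by (rule bounded_by_P_iterate[OF g])
  then have "bounded_by 2 (\<lambda>x. 1 + (P ^^ k) g x)" and "\<And>x. x \<in> space M \<Longrightarrow> 0 \<le> 1 + (P ^^ k) g x"
    by (auto simp: bounded_by_def abs_le_iff)
  then have "Giry_Monad.bind (tilted (\<lambda>x. 1 + (P ^^ k) g x)) kernel = tilted (P (\<lambda>x. 1 + (P ^^ k) g x))"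
    by (rule bind_tilted_kernel)
  also have "\<dots> = tilted (\<lambda>x. 1 + (P ^^ Suc k) g x)"
    unfolding tilted_def using bounded_by_measurable[OF bounded_by_P[OF \<open>bounded_by 2 _\<close>]]
      bounded_by_measurable[OF bounded_by_P[OF bd]] P_one_plus[OF bd]
    by (intro density_cong) auto
  finally show ?case using Suc by simp
qed simp

lemma prob_space_target: "prob_space target"
  by (rule prob_spaceI) (simp add: target_def emeasure_density nn_integral_p cong: nn_integral_cong)

lemma tilted_eq_density:
  assumes "bounded_by C f" "\<And>x. x \<in> space M \<Longrightarrow> 0 \<le> f x"
  shows "tilted f = density target (\<lambda>x. ennreal (f x))"
  unfolding tilted_def target_def using assms p_pos
  by (subst density_density_eq) (auto simp: bounded_by_def ennreal_mult less_imp_le intro!: density_cong AE_I2)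

text \<open>The density \<open>1 + v x\<close> is nonnegative, hence survives the passage through
  \<open>ennreal\<close>, and it agrees almost everywhere with the Radon-Nikodym derivative; its
  deviation from 1 is \<open>v x\<close>.\<close>

lemma chi_square_tilted:
  assumes v: "bounded_by 1 v"
  shows "chi_square (tilted (\<lambda>x. 1 + v x)) target = ennreal (ip v v)"
proof -
  note [measurable] = bounded_by_measurable[OF v]
  interpret T: prob_space target by (rule prob_space_target)
  have bd: "bounded_by 2 (\<lambda>x. 1 + v x)" and nonneg: "\<And>x. x \<in> space M \<Longrightarrow> 0 \<le> 1 + v x"
    using v by (auto simp: bounded_by_def abs_le_iff)
  have sets_target [measurable_cong]: "sets target = sets M" and space_target: "space target = space M"
    by (simp_all add: target_def)
  have d: "density target (\<lambda>x. ennreal (1 + v x)) = tilted (\<lambda>x. 1 + v x)"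
    by (rule tilted_eq_density[OF bd nonneg, symmetric])
  have ac: "absolutely_continuous target (tilted (\<lambda>x. 1 + v x))"
    unfolding d[symmetric] by (rule absolutely_continuousI_density) measurable
  have "AE x in target. ennreal (1 + v x) = RN_deriv target (tilted (\<lambda>x. 1 + v x)) x"
    by (rule T.RN_deriv_unique[OF _ d]) measurable
  then have "(\<integral>\<^sup>+x. ennreal ((enn2real (RN_deriv target (tilted (\<lambda>x. 1 + v x)) x) - 1)\<^sup>2) \<partial>target) =
      (\<integral>\<^sup>+x. ennreal ((v x)\<^sup>2) \<partial>target)"
  proof (intro nn_integral_cong_AE, elim AE_mp, intro AE_I2 impI)
    fix x assume x: "x \<in> space target" and e: "ennreal (1 + v x) = RN_deriv target (tilted (\<lambda>x. 1 + v x)) x"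
    have "0 \<le> 1 + v x" using x nonneg space_target by simp
    then show "ennreal ((enn2real (RN_deriv target (tilted (\<lambda>x. 1 + v x)) x) - 1)\<^sup>2) = ennreal ((v x)\<^sup>2)"
      unfolding e[symmetric] by simp
  qed
  also have "\<dots> = (\<integral>\<^sup>+x. ennreal (p x * (v x * v x)) \<partial>M)"
    unfolding target_def using p_pos
    by (subst nn_integral_density) (auto simp: ennreal_mult power2_eq_square less_imp_le intro!: nn_integral_cong)
  also have "\<dots> = ennreal (ip v v)"
    unfolding ip_def using integrable_ip[OF v v] p_pos
    by (intro nn_integral_eq_integral) (auto simp: less_imp_le)
  finally show ?thesis using ac by (simp add: chi_square_def)
qed

text \<open>The density lies between 0 and 2, which is where \<open>2 \<le> M\<^sub>0\<close>
  enters; mean zero makes its total mass 1.\<close>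

lemma warm_start_tilted:
  assumes g: "bounded_by 1 g" and mean: "(\<integral>x. p x * g x \<partial>M) = 0" and M\<^sub>0: "2 \<le> M\<^sub>0"
  shows "warm_start M\<^sub>0 target (tilted (\<lambda>x. 1 + g x))"
proof -
  note [measurable] = bounded_by_measurable[OF g]
  have bd: "bounded_by 2 (\<lambda>x. 1 + g x)" and nonneg: "\<And>x. x \<in> space M \<Longrightarrow> 0 \<le> 1 + g x"
    using g by (auto simp: bounded_by_def abs_le_iff)
  have "emeasure (tilted (\<lambda>x. 1 + g x)) (space M) = (\<integral>\<^sup>+x. ennreal (p x * (1 + g x)) \<partial>M)"
    unfolding tilted_def by (simp add: emeasure_density cong: nn_integral_cong)
  also have "\<dots> = ennreal (\<integral>x. p x * (1 + g x) \<partial>M)"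
    using integrable_p_bounded[OF bd] p_pos nonneg
    by (intro nn_integral_eq_integral) (auto simp: less_imp_le)
  also have "(\<integral>x. p x * (1 + g x) \<partial>M) = 1"
    using mean integral_p integrable_p integrable_p_bounded[OF g] by (simp add: distrib_left)
  finally have "prob_space (tilted (\<lambda>x. 1 + g x))"
    by (intro prob_spaceI) (simp add: tilted_def)
  moreover have "emeasure (tilted (\<lambda>x. 1 + g x)) E \<le> ennreal M\<^sub>0 * emeasure target E" if "E \<in> sets M" for E
  proof -
    note [measurable] = that
    have "emeasure (tilted (\<lambda>x. 1 + g x)) E = (\<integral>\<^sup>+x. ennreal (p x * (1 + g x)) * indicator E x \<partial>M)"
      unfolding tilted_def by (rule emeasure_density) measurable
    also have "\<dots> \<le> (\<integral>\<^sup>+x. ennreal M\<^sub>0 * (ennreal (p x) * indicator E x) \<partial>M)"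
    proof (intro nn_integral_mono)
      fix x assume x: "x \<in> space M"
      have "p x * (1 + g x) \<le> M\<^sub>0 * p x"
        using bd x M\<^sub>0 p_pos[OF x] by (subst mult.commute) (auto simp: bounded_by_def intro!: mult_right_mono)
      then have "ennreal (p x * (1 + g x)) \<le> ennreal M\<^sub>0 * ennreal (p x)"
        using M\<^sub>0 p_pos[OF x] by (subst ennreal_mult[symmetric]) (auto intro: ennreal_leI)
      then show "ennreal (p x * (1 + g x)) * indicator E x \<le> ennreal M\<^sub>0 * (ennreal (p x) * indicator E x)"
        by (auto split: split_indicator)
    qed
    also have "\<dots> = ennreal M\<^sub>0 * emeasure target E"
      unfolding target_def by (simp add: nn_integral_cmult emeasure_density)
    finally show ?thesis .
  qed
  ultimately show ?thesis
    by (simp add: warm_start_def target_def tilted_def)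
qed

text \<open>Passage to iterated nonnegative integrals, where factoring over coordinates raises no
  question of integrability.\<close>

lemma pair_form_le:
  assumes [measurable]: "F \<in> borel_measurable (M \<Otimes>\<^sub>M M)"
    and F: "\<And>x y. x \<in> space M \<Longrightarrow> y \<in> space M \<Longrightarrow> 0 \<le> F (x, y)"
    and D: "(\<integral>\<^sup>+x. \<integral>\<^sup>+y. ennreal (p x * r x y * F (x, y)) \<partial>M \<partial>M) \<le> ennreal D" "0 \<le> D"
  shows "pair_form F \<le> D"
proof -
  have "pair_form F = enn2real (\<integral>\<^sup>+z. ennreal (p (fst z) * r (fst z) (snd z) * F z) \<partial>(M \<Otimes>\<^sub>M M))"
    unfolding pair_form_def using p_pos r_bounds F
    by (intro integral_eq_nn_integral) (auto simp: space_pair_measure less_imp_le intro!: AE_I2)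
  also have "(\<integral>\<^sup>+z. ennreal (p (fst z) * r (fst z) (snd z) * F z) \<partial>(M \<Otimes>\<^sub>M M)) =
      (\<integral>\<^sup>+x. \<integral>\<^sup>+y. ennreal (p x * r x y * F (x, y)) \<partial>M \<partial>M)"
    using nn_integral_fst[of "\<lambda>z. ennreal (p (fst z) * r (fst z) (snd z) * F z)" M] by simp
  finally show ?thesis using enn2real_mono[OF D(1)] D(2) by simp
qed

end

section \<open>One-dimensional Gaussian integrals\<close>

lemma nn_integral_normal_density:
  "0 < \<sigma> \<Longrightarrow> (\<integral>\<^sup>+x. ennreal (normal_density \<mu> \<sigma> x) \<partial>lborel) = 1"
  by (subst nn_integral_eq_integral) auto

text \<open>Expansion about the mean. The centre \<open>c\<close> is free because a jump is measured
  from the current point and not from the mean of the proposal.\<close>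

lemma nn_integral_normal_second_moment:
  assumes \<sigma>: "0 < \<sigma>"
  shows "(\<integral>\<^sup>+x. ennreal (normal_density \<mu> \<sigma> x * (x - c)\<^sup>2) \<partial>lborel) = ennreal (\<sigma>\<^sup>2 + (\<mu> - c)\<^sup>2)"
proof -
  have "has_bochner_integral lborel (\<lambda>x. normal_density \<mu> \<sigma> x * (x - \<mu>)\<^sup>2 +
      2 * (\<mu> - c) * (normal_density \<mu> \<sigma> x * (x - \<mu>)) + (\<mu> - c)\<^sup>2 * normal_density \<mu> \<sigma> x)
      (\<sigma>\<^sup>2 + 2 * (\<mu> - c) * 0 + (\<mu> - c)\<^sup>2 * 1)"
    using normal_moment_even[OF \<sigma>, of \<mu> 1] normal_moment_odd[OF \<sigma>, of \<mu> 0] normal_moment_even[OF \<sigma>, of \<mu> 0]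
    by (intro has_bochner_integral_add has_bochner_integral_mult_right)
      (auto simp: power2_eq_square)
  moreover have "normal_density \<mu> \<sigma> x * (x - \<mu>)\<^sup>2 + 2 * (\<mu> - c) * (normal_density \<mu> \<sigma> x * (x - \<mu>))
      + (\<mu> - c)\<^sup>2 * normal_density \<mu> \<sigma> x = normal_density \<mu> \<sigma> x * (x - c)\<^sup>2" for x
    by (simp add: power2_eq_square algebra_simps)
  ultimately have "has_bochner_integral lborel (\<lambda>x. normal_density \<mu> \<sigma> x * (x - c)\<^sup>2) (\<sigma>\<^sup>2 + (\<mu> - c)\<^sup>2)"
    by simp
  then show ?thesis
    by (subst nn_integral_eq_integral) (auto simp: has_bochner_integral_iff)
qed

text \<open>One coordinate of the whitened chain. The parameter \<open>l\<close> is a precision, an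
  eigenvalue of the whitened \<open>J\<close>, and not a variance.\<close>

definition coord_target :: "real \<Rightarrow> real \<Rightarrow> real" where
  "coord_target l = normal_density 0 (1 / sqrt l)"

definition coord_proposal :: "real \<Rightarrow> real \<Rightarrow> real \<Rightarrow> real \<Rightarrow> real" where
  "coord_proposal h l u = normal_density ((1 - h * l) * u) (sqrt (2 * h))"

lemma coord_target_measurable [measurable]: "coord_target l \<in> borel_measurable borel"
  by (simp add: coord_target_def)

lemma coord_proposal_measurable [measurable (raw)]:
  assumes [measurable]: "f \<in> borel_measurable M" "g \<in> borel_measurable M"
  shows "(\<lambda>x. coord_proposal h l (f x) (g x)) \<in> borel_measurable M"
  unfolding coord_proposal_def normal_density_def by measurable

lemma coord_target_pos: "0 < l \<Longrightarrow> 0 < coord_target l u"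
  by (simp add: coord_target_def normal_density_pos)

lemma coord_proposal_pos: "0 < h \<Longrightarrow> 0 < coord_proposal h l u v"
  by (simp add: coord_proposal_def normal_density_pos)

lemma nn_integral_coord_target: "0 < l \<Longrightarrow> (\<integral>\<^sup>+u. ennreal (coord_target l u) \<partial>lborel) = 1"
  by (simp add: coord_target_def nn_integral_normal_density)

lemma nn_integral_coord_proposal: "0 < h \<Longrightarrow> (\<integral>\<^sup>+v. ennreal (coord_proposal h l u v) \<partial>lborel) = 1"
  by (simp add: coord_proposal_def nn_integral_normal_density)

lemma nn_integral_coord_joint:
  assumes "0 < l" "0 < h"
  shows "(\<integral>\<^sup>+u. \<integral>\<^sup>+v. ennreal (coord_target l u * coord_proposal h l u v) \<partial>lborel \<partial>lborel) = 1"
proof -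
  have "(\<integral>\<^sup>+v. ennreal (coord_target l u * coord_proposal h l u v) \<partial>lborel) = ennreal (coord_target l u)" for u
    using coord_target_pos[OF assms(1), of u] coord_proposal_pos[OF assms(2), of l u]
    by (simp add: ennreal_mult less_imp_le nn_integral_cmult nn_integral_coord_proposal[OF assms(2)])
  then show ?thesis by (simp add: nn_integral_coord_target assms)
qed

text \<open>Given \<open>u\<close>, the jump has second moment 2 h + (h l u)^2, from noise and
  drift, and u^2 has mean 1 / l. The factor \<open>l\<close> in the integrand rescales the
  coordinate to unit variance, so that only the product h l is left.\<close>

lemma nn_integral_coord_jump:
  assumes l: "0 < l" and h: "0 < h"
  shows "(\<integral>\<^sup>+u. \<integral>\<^sup>+v. ennreal (coord_target l u * coord_proposal h l u v * (l * (u - v)\<^sup>2)) \<partial>lborel \<partial>lborel)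
    = ennreal (2 * (h * l) + (h * l)\<^sup>2)"
proof -
  have "(\<integral>\<^sup>+v. ennreal (coord_target l u * coord_proposal h l u v * (l * (u - v)\<^sup>2)) \<partial>lborel)
      = ennreal (coord_target l u * l * (2 * h + (h * l * u)\<^sup>2))" for u
  proof -
    have "(\<integral>\<^sup>+v. ennreal (coord_target l u * coord_proposal h l u v * (l * (u - v)\<^sup>2)) \<partial>lborel)
      = (\<integral>\<^sup>+v. ennreal (coord_target l u * l) * ennreal (coord_proposal h l u v * (v - u)\<^sup>2) \<partial>lborel)"
      using coord_target_pos[OF l, of u] coord_proposal_pos[OF h, of l u] l
      by (intro nn_integral_cong) (simp add: less_imp_le mult_ac power2_commute flip: ennreal_mult)
    also have "\<dots> = ennreal (coord_target l u * l) * (\<integral>\<^sup>+v. ennreal (coord_proposal h l u v * (v - u)\<^sup>2) \<partial>lborel)"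
      by (rule nn_integral_cmult) measurable
    also have "(\<integral>\<^sup>+v. ennreal (coord_proposal h l u v * (v - u)\<^sup>2) \<partial>lborel) = ennreal (2 * h + (h * l * u)\<^sup>2)"
      unfolding coord_proposal_def using h
      by (subst nn_integral_normal_second_moment) (auto simp: algebra_simps power2_eq_square)
    finally show ?thesis
      using coord_target_pos[OF l, of u] l h by (simp add: less_imp_le ennreal_mult del: ennreal_plus)
  qed
  also have "ennreal (coord_target l u * l * (2 * h + (h * l * u)\<^sup>2)) = ennreal (2 * (h * l)) * ennreal (coord_target l u) +
         ennreal (h\<^sup>2 * l ^ 3) * ennreal (coord_target l u * (u - 0)\<^sup>2)" for u
  proof -
    have "coord_target l u * l * (2 * h + (h * l * u)\<^sup>2) =
        2 * (h * l) * coord_target l u + h\<^sup>2 * l ^ 3 * (coord_target l u * (u - 0)\<^sup>2)"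
      by (simp add: algebra_simps power2_eq_square power3_eq_cube)
    then show ?thesis
      using coord_target_pos[OF l, of u] l h by (simp add: less_imp_le ennreal_mult)
  qed
  finally have "(\<integral>\<^sup>+u. \<integral>\<^sup>+v. ennreal (coord_target l u * coord_proposal h l u v * (l * (u - v)\<^sup>2)) \<partial>lborel \<partial>lborel)
    = (\<integral>\<^sup>+u. ennreal (2 * (h * l)) * ennreal (coord_target l u) +
         ennreal (h\<^sup>2 * l ^ 3) * ennreal (coord_target l u * (u - 0)\<^sup>2) \<partial>lborel)"
    by (intro nn_integral_cong)
  also have "\<dots> = ennreal (2 * (h * l)) * (\<integral>\<^sup>+u. ennreal (coord_target l u) \<partial>lborel) +
      ennreal (h\<^sup>2 * l ^ 3) * (\<integral>\<^sup>+u. ennreal (coord_target l u * (u - 0)\<^sup>2) \<partial>lborel)"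
    by (subst nn_integral_add) (auto simp: nn_integral_cmult)
  also have "(\<integral>\<^sup>+u. ennreal (coord_target l u * (u - 0)\<^sup>2) \<partial>lborel) = ennreal (1 / l)"
    unfolding coord_target_def using l
    by (subst nn_integral_normal_second_moment) (auto simp: power_divide)
  finally show ?thesis
    using l h by (simp add: nn_integral_coord_target power2_eq_square power3_eq_cube field_simps
        flip: ennreal_mult ennreal_plus)
qed

text \<open>Up to a constant the square root is a planar Gaussian with precision matrix of diagonal
  entries A and off-diagonal entries B = - (1 - h l) / (2 h). It is factored into a law of
  \<open>u\<close> and a conditional law of \<open>v\<close>, and \<open>D\<close> is the
  determinant. With s = h l, the terms of order s^2 cancel in A^2 - B^2 and s (8 + s^3) / (16 h^2)
  remains: this is the origin of the third power.\<close>

lemma sqrt_detailed_balance_product: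
  assumes l: "0 < l" and h: "0 < h"
  defines "A \<equiv> l / 2 + (1 + (1 - h * l)\<^sup>2) / (4 * h)"
    and "D \<equiv> l / (2 * h) * (1 + (h * l) ^ 3 / 8)"
  shows "sqrt (coord_target l u * coord_proposal h l u v * (coord_target l v * coord_proposal h l v u)) =
    1 / sqrt (1 + (h * l) ^ 3 / 8) *
     (normal_density 0 (sqrt (A / D)) u * normal_density ((1 - h * l) / (2 * h * A) * u) (1 / sqrt A) v)"
proof -
  define B where "B = - (1 - h * l) / (2 * h)"
  define K where "K = 1 + (h * l) ^ 3 / 8"
  have K: "K > 0" using l h by (simp add: K_def add_pos_pos)
  have A: "A > 0" using l h by (simp add: A_def add_pos_nonneg)
  have D: "D > 0" "D = l / (2 * h) * K" using l h K by (simp_all add: D_def K_def)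
  have AB: "D = A\<^sup>2 - B\<^sup>2"
    unfolding D_def A_def B_def using h l by (simp add: field_simps power2_eq_square power3_eq_cube)
  have m: "(1 - h * l) / (2 * h * A) = - B / A" using h A by (simp add: B_def field_simps)
  \<comment> \<open>The exponents of both joint densities are collected before the root is taken;
    hence the factor 2 on the right.\<close>
  have E: "- (u\<^sup>2 * l / 2) - (v - (1 - h * l) * u)\<^sup>2 / (4 * h) - v\<^sup>2 * l / 2 - (u - (1 - h * l) * v)\<^sup>2 / (4 * h)
     = 2 * (- (u\<^sup>2 * D / (2 * A)) - (v - (- B / A) * u)\<^sup>2 * A / 2)"
  proof -
    have "- (u\<^sup>2 * l / 2) - (v - (1 - h * l) * u)\<^sup>2 / (4 * h) - v\<^sup>2 * l / 2 - (u - (1 - h * l) * v)\<^sup>2 / (4 * h)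
      = - A * (u\<^sup>2 + v\<^sup>2) - 2 * B * (u * v)"
      unfolding A_def B_def using h by (simp add: field_simps power2_eq_square)
    also have "\<dots> = 2 * (- (u\<^sup>2 * D / (2 * A)) - (v - (- B / A) * u)\<^sup>2 * A / 2)"
      unfolding AB using A by (simp add: field_simps power2_eq_square)
    finally show ?thesis .
  qed
  have t: "coord_target l x = sqrt (l / (2 * pi)) * exp (- (x\<^sup>2 * l / 2))" for x
    using l by (simp add: coord_target_def normal_density_def power_divide real_sqrt_divide)
  have q: "coord_proposal h l x y = 1 / sqrt (4 * pi * h) * exp (- ((y - (1 - h * l) * x)\<^sup>2 / (4 * h)))" for x y
    using h by (simp add: coord_proposal_def normal_density_def mult_ac)
  have lhs: "coord_target l u * coord_proposal h l u v * (coord_target l v * coord_proposal h l v u) =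
      l / (2 * pi) / (4 * pi * h) *
      exp (- (u\<^sup>2 * l / 2) - (v - (1 - h * l) * u)\<^sup>2 / (4 * h) - v\<^sup>2 * l / 2 - (u - (1 - h * l) * v)\<^sup>2 / (4 * h))"
  proof -
    have "coord_target l u * coord_proposal h l u v * (coord_target l v * coord_proposal h l v u) =
      (sqrt (l / (2 * pi)) * sqrt (l / (2 * pi))) * ((1 / sqrt (4 * pi * h)) * (1 / sqrt (4 * pi * h))) *
      (exp (- (u\<^sup>2 * l / 2)) * exp (- ((v - (1 - h * l) * u)\<^sup>2 / (4 * h))) *
       exp (- (v\<^sup>2 * l / 2)) * exp (- ((u - (1 - h * l) * v)\<^sup>2 / (4 * h))))"
      unfolding t q by (simp only: mult_ac)
    also have "sqrt (l / (2 * pi)) * sqrt (l / (2 * pi)) = l / (2 * pi)" using l by simp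
    also have "(1 / sqrt (4 * pi * h)) * (1 / sqrt (4 * pi * h)) = 1 / (4 * pi * h)" using h by simp
    also have "exp (- (u\<^sup>2 * l / 2)) * exp (- ((v - (1 - h * l) * u)\<^sup>2 / (4 * h))) *
       exp (- (v\<^sup>2 * l / 2)) * exp (- ((u - (1 - h * l) * v)\<^sup>2 / (4 * h))) =
       exp (- (u\<^sup>2 * l / 2) - (v - (1 - h * l) * u)\<^sup>2 / (4 * h) - v\<^sup>2 * l / 2 - (u - (1 - h * l) * v)\<^sup>2 / (4 * h))"
      by (simp add: exp_add[symmetric])
    finally show ?thesis by simp
  qed
  have n: "normal_density \<mu> (sqrt V) x = 1 / sqrt (2 * pi * V) * exp (- ((x - \<mu>)\<^sup>2 / (2 * V)))" if "V > 0" for \<mu> V x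
    using that by (simp add: normal_density_def)
  have n1: "normal_density 0 (sqrt (A / D)) u = 1 / sqrt (2 * pi * (A / D)) * exp (- (u\<^sup>2 * D / (2 * A)))"
    using n[of "A / D" 0 u] A D(1) by simp
  have n2: "normal_density ((1 - h * l) / (2 * h * A) * u) (1 / sqrt A) v
      = 1 / sqrt (2 * pi * (1 / A)) * exp (- ((v - (- B / A) * u)\<^sup>2 * A / 2))"
    unfolding m using n[of "1 / A" "- B / A * u" v] A by (simp add: real_sqrt_divide)
  \<comment> \<open>The identity is checked after squaring, as both sides of the claim are
    nonnegative.\<close>
  have "(1 / sqrt K * (normal_density 0 (sqrt (A / D)) u *
      normal_density ((1 - h * l) / (2 * h * A) * u) (1 / sqrt A) v))\<^sup>2
     = (1 / sqrt K)\<^sup>2 * (1 / sqrt (2 * pi * (A / D)))\<^sup>2 * (1 / sqrt (2 * pi * (1 / A)))\<^sup>2 *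
       (exp (- (u\<^sup>2 * D / (2 * A))) * exp (- ((v - (- B / A) * u)\<^sup>2 * A / 2)))\<^sup>2"
    unfolding n1 n2 by (simp only: power_mult_distrib mult_ac)
  also have "exp (- (u\<^sup>2 * D / (2 * A))) * exp (- ((v - (- B / A) * u)\<^sup>2 * A / 2)) =
      exp (- (u\<^sup>2 * D / (2 * A)) - (v - (- B / A) * u)\<^sup>2 * A / 2)"
    by (simp add: exp_add[symmetric])
  also have "(exp (- (u\<^sup>2 * D / (2 * A)) - (v - (- B / A) * u)\<^sup>2 * A / 2))\<^sup>2 =
      exp (2 * (- (u\<^sup>2 * D / (2 * A)) - (v - (- B / A) * u)\<^sup>2 * A / 2))"
    by (rule exp_double[symmetric])
  also have "(1 / sqrt K)\<^sup>2 * (1 / sqrt (2 * pi * (A / D)))\<^sup>2 * (1 / sqrt (2 * pi * (1 / A)))\<^sup>2 =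
      1 / K * (1 / (2 * pi * (A / D))) * (1 / (2 * pi * (1 / A)))"
    using A D(1) K by (simp add: power_divide)
  also have "\<dots> = l / (2 * pi) / (4 * pi * h)"
    unfolding D(2) using A K h l by (simp add: field_simps)
  finally have "coord_target l u * coord_proposal h l u v * (coord_target l v * coord_proposal h l v u) =
     (1 / sqrt K * (normal_density 0 (sqrt (A / D)) u *
      normal_density ((1 - h * l) / (2 * h * A) * u) (1 / sqrt A) v))\<^sup>2"
    unfolding lhs E by simp
  then show ?thesis
    using K by (simp add: K_def)
qed

text \<open>This is the Hellinger affinity between the joint law of point and proposal and its
  reversal. After the factorization both Gaussian factors integrate to 1 and only the constant is
  left.\<close>

lemma nn_integral_coord_affinity:
  assumes l: "0 < l" and h: "0 < h"
  shows "(\<integral>\<^sup>+u. \<integral>\<^sup>+v. ennreal (sqrt (coord_target l u * coord_proposal h l u v *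
      (coord_target l v * coord_proposal h l v u))) \<partial>lborel \<partial>lborel) = ennreal (1 / sqrt (1 + (h * l) ^ 3 / 8))"
proof -
  define A where "A = l / 2 + (1 + (1 - h * l)\<^sup>2) / (4 * h)"
  define D where "D = l / (2 * h) * (1 + (h * l) ^ 3 / 8)"
  define c where "c = 1 / sqrt (1 + (h * l) ^ 3 / 8)"
  have A: "A > 0" using l h by (simp add: A_def add_pos_nonneg)
  have D: "D > 0" using l h by (simp add: D_def add_pos_pos)
  have c: "c \<ge> 0" using l h by (simp add: c_def)
  have "(\<integral>\<^sup>+v. ennreal (sqrt (coord_target l u * coord_proposal h l u v *
      (coord_target l v * coord_proposal h l v u))) \<partial>lborel)
    = ennreal (c * normal_density 0 (sqrt (A / D)) u)" for u
  proof -
    have "(\<integral>\<^sup>+v. ennreal (sqrt (coord_target l u * coord_proposal h l u v *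
        (coord_target l v * coord_proposal h l v u))) \<partial>lborel)
      = (\<integral>\<^sup>+v. ennreal (c * normal_density 0 (sqrt (A / D)) u) *
          ennreal (normal_density ((1 - h * l) / (2 * h * A) * u) (1 / sqrt A) v) \<partial>lborel)"
      unfolding sqrt_detailed_balance_product[OF l h] using c
      by (intro nn_integral_cong) (simp add: A_def D_def c_def mult_ac flip: ennreal_mult)
    also have "\<dots> = ennreal (c * normal_density 0 (sqrt (A / D)) u)"
      using A by (simp add: nn_integral_cmult nn_integral_normal_density)
    finally show ?thesis .
  qed
  then show ?thesis
    using A D c by (simp add: ennreal_mult nn_integral_cmult nn_integral_normal_density flip: c_def)
qed

section \<open>The truncated standard normal coordinate\<close>

definition clamp1 :: "real \<Rightarrow> real" where
  "clamp1 t = max (- 1) (min 1 t)"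

lemma clamp1_measurable [measurable]: "clamp1 \<in> borel_measurable borel"
  unfolding clamp1_def[abs_def] by measurable

lemma clamp1_bound: "\<bar>clamp1 t\<bar> \<le> 1"
  by (auto simp: clamp1_def)

lemma clamp1_minus: "clamp1 (- t) = - clamp1 t"
  by (auto simp: clamp1_def)

lemma clamp1_lipschitz: "(clamp1 s - clamp1 t)\<^sup>2 \<le> (s - t)\<^sup>2"
  unfolding abs_le_square_iff[symmetric] by (auto simp: clamp1_def)

text \<open>The universal number behind both \<open>c\<^sub>3\<close> and \<open>c\<^sub>4\<close>.
  Its value is never computed: it is positive and at most 1. Since the truncated variable is
  centred, the second moment is the variance.\<close>

definition clamp_variance :: real where
  "clamp_variance = (\<integral>t. std_normal_density t * (clamp1 t * clamp1 t) \<partial>lborel)"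

lemma integrable_std_normal_bounded:
  assumes [measurable]: "f \<in> borel_measurable borel" and "\<And>t. \<bar>f t\<bar> \<le> 1"
  shows "integrable lborel (\<lambda>t. std_normal_density t * f t)"
  by (rule Bochner_Integration.integrable_bound[of _ std_normal_density])
    (use assms(2) in \<open>auto simp: abs_mult intro!: mult_left_le\<close>)

lemma integral_std_normal_clamp1: "(\<integral>t. std_normal_density t * clamp1 t \<partial>lborel) = 0"
proof -
  have "(\<integral>t. std_normal_density t * clamp1 t \<partial>lborel) = (\<integral>t. - (std_normal_density t * clamp1 t) \<partial>lborel)"
    using lborel_integral_real_affine[of "-1" "\<lambda>t. std_normal_density t * clamp1 t" 0]
    by (simp add: clamp1_minus std_normal_density_def)
  then show ?thesis by simp
qed

lemma clamp1_sq_bound: "\<bar>clamp1 t * clamp1 t\<bar> \<le> 1"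
  using clamp1_bound[of t] mult_le_one[of "\<bar>clamp1 t\<bar>" "\<bar>clamp1 t\<bar>"] by (simp add: abs_mult del: abs_mult_self_eq)

lemma clamp_variance_pos: "0 < clamp_variance"
proof -
  have int: "integrable lborel (\<lambda>t. std_normal_density t * (clamp1 t * clamp1 t))"
    by (rule integrable_std_normal_bounded[OF _ clamp1_sq_bound]) measurable
  have "clamp_variance \<ge> 0"
    unfolding clamp_variance_def by (rule Bochner_Integration.integral_nonneg) simp
  moreover have "clamp_variance \<noteq> 0"
  proof
    assume "clamp_variance = 0"
    \<comment> \<open>A vanishing integral would force \<open>clamp1 t = 0\<close> for almost every
      t, but \<open>clamp1\<close> vanishes only at 0.\<close>
    then have "AE t in lborel. std_normal_density t * (clamp1 t * clamp1 t) = 0"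
      unfolding clamp_variance_def
      by (subst (asm) integral_nonneg_eq_0_iff_AE[OF int]) auto
    moreover have "AE t in lborel. t \<noteq> (0::real)" by (rule AE_lborel_singleton)
    ultimately have "AE t in lborel :: real measure. False"
    proof eventually_elim
      case (elim t)
      then show ?case using normal_density_pos[of 1 0 t] by (auto simp: clamp1_def max_def min_def split: if_splits)
    qed
    then have "emeasure lborel (UNIV :: real set) = 0"
      by (simp add: AE_iff_measurable[OF _ refl])
    then show False by simp
  qed
  ultimately show ?thesis by simp
qed

lemma clamp_variance_le_1: "clamp_variance \<le> 1"
proof -
  have "clamp1 t * clamp1 t \<le> 1" for t using clamp1_sq_bound[of t] by linarith
  then have "clamp_variance \<le> (\<integral>t. std_normal_density t \<partial>lborel)"
    unfolding clamp_variance_def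
    by (intro integral_mono integrable_std_normal_bounded)
      (auto simp: clamp1_sq_bound simp del: abs_mult_self_eq intro!: mult_left_le)
  then show ?thesis by simp
qed

section \<open>Whitened coordinates\<close>

lemma inverse_mat:
  assumes A: "A \<in> carrier_mat d d" and det: "Determinant.det A \<noteq> 0"
  shows "inverse_mat A \<in> carrier_mat d d" "A * inverse_mat A = 1\<^sub>m d" "inverse_mat A * A = 1\<^sub>m d"
proof -
  obtain B where "mat_inverse A = Some B"
    using mat_inverse(1)[OF A, of "()"] det_non_zero_imp_unit[OF A det, of "()"] by (cases "mat_inverse A") auto
  then show "inverse_mat A \<in> carrier_mat d d" "A * inverse_mat A = 1\<^sub>m d" "inverse_mat A * A = 1\<^sub>m d"
    using mat_inverse(2)[OF A] by (auto simp: inverse_mat_def)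
qed

lemma inverse_mat_unique:
  assumes A: "A \<in> carrier_mat d d" and B: "B \<in> carrier_mat d d" and AB: "A * B = 1\<^sub>m d"
  shows "inverse_mat A = B"
proof -
  have "Determinant.det A * Determinant.det B = 1"
    using det_mult[OF A B] AB by simp
  then have "Determinant.det A \<noteq> 0" by auto
  note inv = inverse_mat[OF A this]
  have "inverse_mat A = inverse_mat A * (A * B)" using inv AB by simp
  also have "\<dots> = (inverse_mat A * A) * B" by (rule assoc_mult_mat[OF inv(1) A B, symmetric])
  also have "\<dots> = B" using inv B by simp
  finally show ?thesis .
qed

lemma smult_mat_mult_vec:
  "A \<in> carrier_mat n m \<Longrightarrow> v \<in> carrier_vec m \<Longrightarrow> (k \<cdot>\<^sub>m A) *\<^sub>v v = (k :: real) \<cdot>\<^sub>v (A *\<^sub>v v)"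
  by (intro eq_vecI) (auto simp: scalar_prod_def sum_distrib_left mult.assoc)

lemma vec_affine_map:
  assumes "A \<in> carrier_mat d d"
  shows "Matrix.vec d (affine_map d A (\<lambda>_. 0) x) = A *\<^sub>v Matrix.vec d x"
proof (rule eq_vecI)
  fix i assume "i < dim_vec (A *\<^sub>v Matrix.vec d x)"
  then show "vec_index (Matrix.vec d (affine_map d A (\<lambda>_. 0) x)) i = vec_index (A *\<^sub>v Matrix.vec d x) i"
    using assms by (simp add: mult_mat_vec_sum[OF assms] affine_map_def del: index_mult_mat_vec)
qed (use assms in auto)

lemma sqrt_prod: "sqrt (\<Prod>i\<in>A. f i) = (\<Prod>i\<in>A. sqrt (f i))"
  by (induction A rule: infinite_finite_induct) (auto simp: real_sqrt_mult)

lemma space_lebesgue_Rn: "space (lebesgue_Rn d) = extensional {..<d}"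
  by (simp add: space_PiM PiE_UNIV_domain PiE_def)

lemma vec_eq_imp_eq:
  assumes "x \<in> space (lebesgue_Rn d)" "y \<in> space (lebesgue_Rn d)" "Matrix.vec d x = Matrix.vec d y"
  shows "x = y"
proof (rule extensionalityI[of _ "{..<d}"])
  show "x i = y i" if "i \<in> {..<d}" for i
    using that arg_cong[OF assms(3), of "\<lambda>v. vec_index v i"] by simp
qed (use assms in \<open>auto simp: space_lebesgue_Rn\<close>)

lemma affine_map_in_space: "affine_map d A v x \<in> space (lebesgue_Rn d)"
  by (simp add: space_lebesgue_Rn affine_map_def)

lemma det_mat_diag: "Determinant.det (mat_diag d l :: real mat) = (\<Prod>i<d. l i)"
proof -
  have "Determinant.det (mat_diag d l :: real mat) = prod_list (diag_mat (mat_diag d l))"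
    by (rule det_upper_triangular[of _ d]) (auto simp: mat_diag_def)
  then show ?thesis
    by (simp add: prod_list_diag_prod mat_diag_def atLeast0LessThan)
qed

text \<open>The diagonal \<open>l\<close> stays arbitrary here and is specialized to two values only
  in the theorem. The assumption \<open>S * J * S = mat_diag d l\<close> says that the target has
  independent coordinates in the variable u with x = S u.\<close>

locale gaussian_mala =
  fixes d :: nat and I S J :: "real mat" and l :: "nat \<Rightarrow> real" and h :: real
  assumes spd_I: "spd_mat d I" and sqrt_I: "spd_sqrt d I S" and spd_J: "spd_mat d J"
    and diagonalized: "S * J * S = mat_diag d l" and h: "0 < h"
begin

definition R :: "real mat" where
  "R = inverse_mat S"

definition whiten :: "(nat \<Rightarrow> real) \<Rightarrow> nat \<Rightarrow> real" where
  "whiten = affine_map d R (\<lambda>_. 0)"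

lemma I: "I \<in> carrier_mat d d" and J: "J \<in> carrier_mat d d" and spd_S: "spd_mat d S"
  and S: "S \<in> carrier_mat d d" and S_transpose: "transpose_mat S = S" and S_S: "S * S = I"
  using spd_I spd_J sqrt_I by (auto simp: spd_mat_def spd_sqrt_def)

lemma det_S: "Determinant.det S \<noteq> 0"
  by (rule spd_mat_det_nonzero[OF spd_S])

lemma R: "R \<in> carrier_mat d d" and S_R: "S * R = 1\<^sub>m d" and R_S: "R * S = 1\<^sub>m d"
  using inverse_mat[OF S det_S] by (auto simp: R_def)

lemma R_S_vec: "v \<in> carrier_vec d \<Longrightarrow> R *\<^sub>v (S *\<^sub>v v) = v"
  using assoc_mult_mat_vec[OF R S, of v] by (simp add: R_S)

lemma S_R_vec: "v \<in> carrier_vec d \<Longrightarrow> S *\<^sub>v (R *\<^sub>v v) = v"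
  using assoc_mult_mat_vec[OF S R, of v] by (simp add: S_R)

lemma vec_whiten: "Matrix.vec d (whiten x) = R *\<^sub>v Matrix.vec d x"
  unfolding whiten_def by (rule vec_affine_map[OF R])

lemma whiten_in_space: "whiten x \<in> space (lebesgue_Rn d)"
  by (simp add: whiten_def affine_map_in_space)

lemma S_vec_whiten: "S *\<^sub>v Matrix.vec d (whiten x) = Matrix.vec d x"
  by (simp add: vec_whiten S_R_vec)

lemma whiten_S: "u \<in> space (lebesgue_Rn d) \<Longrightarrow> whiten (affine_map d S (\<lambda>_. 0) u) = u"
  by (rule vec_eq_imp_eq[OF whiten_in_space]) (auto simp: vec_whiten vec_affine_map[OF S] R_S_vec)

lemma whiten_measurable [measurable]: "whiten \<in> lebesgue_Rn d \<rightarrow>\<^sub>M lebesgue_Rn d"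
  unfolding whiten_def by (rule measurable_affine_map)

text \<open>The substitution is made with \<open>S\<close> and not with its inverse:
  \<open>S\<close> is known to be positive definite, so the change of variables applies to it
  directly.\<close>

lemma nn_integral_whiten:
  assumes [measurable]: "F \<in> borel_measurable (lebesgue_Rn d)"
  shows "(\<integral>\<^sup>+x. F (whiten x) \<partial>lebesgue_Rn d) = ennreal \<bar>Determinant.det S\<bar> * (\<integral>\<^sup>+u. F u \<partial>lebesgue_Rn d)"
proof -
  have "(\<integral>\<^sup>+x. F (whiten x) \<partial>lebesgue_Rn d) = ennreal \<bar>Determinant.det S\<bar> *
      (\<integral>\<^sup>+u. F (whiten (affine_map d S (\<lambda>_. 0) u)) \<partial>lebesgue_Rn d)"
    by (rule nn_integral_affine_map[OF spd_S]) measurable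
  also have "(\<integral>\<^sup>+u. F (whiten (affine_map d S (\<lambda>_. 0) u)) \<partial>lebesgue_Rn d) = (\<integral>\<^sup>+u. F u \<partial>lebesgue_Rn d)"
    by (intro nn_integral_cong) (simp add: whiten_S)
  finally show ?thesis .
qed

lemma S_scalar_prod:
  "v \<in> carrier_vec d \<Longrightarrow> w \<in> carrier_vec d \<Longrightarrow> scalar_prod (S *\<^sub>v v) w = scalar_prod v (S *\<^sub>v w)"
  using transpose_vec_mult_scalar[OF S, of w v] by (simp add: S_transpose)

lemma S_J_S_vec: "v \<in> carrier_vec d \<Longrightarrow> S *\<^sub>v (J *\<^sub>v (S *\<^sub>v v)) = mat_diag d l *\<^sub>v v"
  using S J by (simp add: assoc_mult_mat_vec[of _ d d _ d] flip: diagonalized)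

lemma mat_diag_vec_index:
  "v \<in> carrier_vec d \<Longrightarrow> i < d \<Longrightarrow> vec_index (mat_diag d l *\<^sub>v v) i = l i * vec_index v i"
  by (subst mult_mat_vec_sum[of _ d])
    (auto simp: mat_diag_def if_distrib[of "\<lambda>x. x * _"] cong: if_cong)

lemma J_quadratic:
  assumes "v \<in> carrier_vec d"
  shows "scalar_prod (S *\<^sub>v v) (J *\<^sub>v (S *\<^sub>v v)) = (\<Sum>i<d. l i * (vec_index v i)\<^sup>2)"
proof -
  have "scalar_prod (S *\<^sub>v v) (J *\<^sub>v (S *\<^sub>v v)) = scalar_prod v (mat_diag d l *\<^sub>v v)"
    using S J assms by (subst S_scalar_prod) (auto simp: S_J_S_vec)
  also have "\<dots> = (\<Sum>i<d. l i * (vec_index v i)\<^sup>2)"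
    using assms by (subst scalar_prod_sum[of _ d])
      (auto simp: mat_diag_vec_index power2_eq_square mult_ac carrier_matD(1)[OF mat_diag_dim]
        simp del: index_mult_mat_vec intro!: sum.cong)
  finally show ?thesis .
qed

text \<open>\<open>l i\<close> is the value of the quadratic form of \<open>J\<close> at the image
  under \<open>S\<close> of a unit vector. This supplies the positivity of
  \<open>\<rho>\<^sub>1\<close> and \<open>\<rho>\<^sub>2\<close>, which the theorem does not
  assume.\<close>

lemma l_pos:
  assumes i: "i < d"
  shows "0 < l i"
proof -
  let ?e = "unit_vec d i :: real Matrix.vec"
  have "?e = 0\<^sub>v d" if "S *\<^sub>v ?e = 0\<^sub>v d"
  proof -
    have "R *\<^sub>v 0\<^sub>v d = 0\<^sub>v d" using R by (intro eq_vecI) auto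
    then have "R *\<^sub>v (S *\<^sub>v ?e) = 0\<^sub>v d" using that by simp
    then show ?thesis by (simp add: R_S_vec)
  qed
  moreover have "?e \<noteq> 0\<^sub>v d"
    using arg_cong[of ?e "0\<^sub>v d" "\<lambda>v. vec_index v i"] i by auto
  ultimately have "S *\<^sub>v ?e \<noteq> 0\<^sub>v d" by auto
  then have "0 < scalar_prod (S *\<^sub>v ?e) (J *\<^sub>v (S *\<^sub>v ?e))"
    using spd_J S by (auto simp: spd_mat_def)
  also have "\<dots> = (\<Sum>j<d. l j * (vec_index ?e j)\<^sup>2)" by (rule J_quadratic) simp
  also have "\<dots> = (\<Sum>j<d. if j = i then l j else 0)" using i by (intro sum.cong) auto
  also have "\<dots> = l i" using i by simp
  finally show ?thesis .
qed

lemma prod_l_pos: "0 < (\<Prod>i<d. l i)"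
  by (intro prod_pos) (auto simp: l_pos)

section \<open>Target and proposal densities as products over whitened coordinates\<close>

lemma det_J: "Determinant.det J = (\<Prod>i<d. l i) / (Determinant.det S)\<^sup>2"
proof -
  have "Determinant.det (S * J * S) = Determinant.det S * Determinant.det J * Determinant.det S"
    using S J by (simp add: det_mult[of _ d])
  then show ?thesis
    using det_S by (simp add: diagonalized det_mat_diag power2_eq_square field_simps)
qed

text \<open>The density inverts its covariance \<open>inverse_mat J\<close> back to
  \<open>J\<close>, whose quadratic form is diagonal in the whitened point. Densities still refer to
  Lebesgue measure in x, hence the Jacobian in the denominator.\<close>

lemma target_density_eq:
  "target_density d J x = (\<Prod>i<d. coord_target (l i) (whiten x i)) / \<bar>Determinant.det S\<bar>"
proof -
  let ?v = "Matrix.vec d (whiten x)"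
  let ?P = "\<Prod>i<d. l i"
  note invJ = inverse_mat[OF J spd_mat_det_nonzero[OF spd_J]]
  have JJ: "inverse_mat (inverse_mat J) = J"
    by (rule inverse_mat_unique[OF invJ(1) J invJ(3)])
  have "Determinant.det J * Determinant.det (inverse_mat J) = 1"
    using det_mult[OF J invJ(1)] invJ(2) by simp
  then have det: "Determinant.det (inverse_mat J) = (Determinant.det S)\<^sup>2 / ?P"
  proof -
    have "x = D\<^sup>2 / P" if "P / D\<^sup>2 * x = 1" "P > 0" "D \<noteq> 0" for x D P :: real
      using that by (simp add: field_simps)
    then show ?thesis using \<open>Determinant.det J * _ = 1\<close> prod_l_pos det_S unfolding det_J by blast
  qed
  have z: "Matrix.vec d x - 0\<^sub>v d = S *\<^sub>v ?v"
    by (simp add: S_vec_whiten)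
  have q: "scalar_prod (S *\<^sub>v ?v) (J *\<^sub>v (S *\<^sub>v ?v)) = (\<Sum>i<d. l i * (whiten x i)\<^sup>2)"
    by (subst J_quadratic) (auto intro!: sum.cong)
  have "target_density d J x = exp (- (1 / 2) * (\<Sum>i<d. l i * (whiten x i)\<^sup>2)) /
      sqrt ((2 * pi) ^ d * ((Determinant.det S)\<^sup>2 / ?P))"
    unfolding target_density_def gauss_density_def Let_def JJ z q det ..
  also have "exp (- (1 / 2) * (\<Sum>i<d. l i * (whiten x i)\<^sup>2)) = (\<Prod>i<d. exp (- ((whiten x i)\<^sup>2 * l i / 2)))"
    by (simp add: exp_sum[symmetric] sum_negf sum_divide_distrib mult_ac)
  also have "sqrt ((2 * pi) ^ d * ((Determinant.det S)\<^sup>2 / ?P)) = \<bar>Determinant.det S\<bar> / sqrt (\<Prod>i<d. l i / (2 * pi))"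
    by (simp add: prod_dividef real_sqrt_mult real_sqrt_divide)
  also have "(\<Prod>i<d. exp (- ((whiten x i)\<^sup>2 * l i / 2))) / (\<bar>Determinant.det S\<bar> / sqrt (\<Prod>i<d. l i / (2 * pi)))
      = (\<Prod>i<d. sqrt (l i / (2 * pi)) * exp (- ((whiten x i)\<^sup>2 * l i / 2))) / \<bar>Determinant.det S\<bar>"
    by (simp only: sqrt_prod prod.distrib) simp
  also have "(\<Prod>i<d. sqrt (l i / (2 * pi)) * exp (- ((whiten x i)\<^sup>2 * l i / 2))) = (\<Prod>i<d. coord_target (l i) (whiten x i))"
    using l_pos by (intro prod.cong) (auto simp: coord_target_def normal_density_def power_divide real_sqrt_divide less_imp_le)
  finally show ?thesis .
qed

text \<open>As I J S = S (S J S), the deviation of \<open>y\<close> from the proposal mean is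
  \<open>S\<close> applied to a vector \<open>e\<close> whose entries each involve one coordinate
  only. The covariance 2 h S S becomes 2 h times the identity for \<open>e\<close>.\<close>

lemma proposal_eq:
  "mala_proposal d I J h x y =
    (\<Prod>i<d. coord_proposal h (l i) (whiten x i) (whiten y i)) / \<bar>Determinant.det S\<bar>"
proof -
  let ?u = "Matrix.vec d (whiten x)" and ?v = "Matrix.vec d (whiten y)"
  define e where "e = ?v - (?u - h \<cdot>\<^sub>v (mat_diag d l *\<^sub>v ?u))"
  have D: "mat_diag d l *\<^sub>v ?u \<in> carrier_vec d"
    by (rule mult_mat_vec_carrier[OF mat_diag_dim]) simp
  have e: "e \<in> carrier_vec d" using D by (simp add: e_def)
  have e_index: "vec_index e i = whiten y i - (1 - h * l i) * whiten x i" if "i < d" for i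
  proof -
    have "vec_index e i = whiten y i - (whiten x i - h * vec_index (mat_diag d l *\<^sub>v ?u) i)"
      using that carrier_vecD[OF D] by (simp add: e_def del: index_mult_mat_vec dim_mult_mat_vec)
    then show ?thesis using that by (simp add: mat_diag_vec_index algebra_simps del: index_mult_mat_vec)
  qed
  have IJ: "I *\<^sub>v (J *\<^sub>v (S *\<^sub>v ?u)) = S *\<^sub>v (mat_diag d l *\<^sub>v ?u)"
    using S J by (simp add: S_S[symmetric] assoc_mult_mat_vec[of _ d d _ d] S_J_S_vec)
  have z: "Matrix.vec d y - (Matrix.vec d x - h \<cdot>\<^sub>v (I *\<^sub>v (J *\<^sub>v Matrix.vec d x))) = S *\<^sub>v e"
    unfolding S_vec_whiten[symmetric, of x] S_vec_whiten[symmetric, of y] IJ e_def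
    using S D by (simp add: mult_minus_distrib_mat_vec[OF S] mult_mat_vec[OF S])
  have inv: "inverse_mat ((2 * h) \<cdot>\<^sub>m I) = (1 / (2 * h)) \<cdot>\<^sub>m (R * R)"
  proof (rule inverse_mat_unique[of _ d])
    have "((2 * h) \<cdot>\<^sub>m I) * ((1 / (2 * h)) \<cdot>\<^sub>m (R * R)) = I * (R * R)"
      using I R h by (intro eq_matI) (simp_all add: mult_smult_distrib[of _ d d _ d] mult_smult_assoc_mat[of _ d d _ d])
    also have "\<dots> = S * (S * R) * R"
      using S R by (simp add: S_S[symmetric] assoc_mult_mat[of _ d d _ d _ d])
    also have "\<dots> = 1\<^sub>m d" using S R by (simp add: S_R)
    finally show "((2 * h) \<cdot>\<^sub>m I) * ((1 / (2 * h)) \<cdot>\<^sub>m (R * R)) = 1\<^sub>m d" .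
  qed (use I R in auto)
  have q: "scalar_prod (S *\<^sub>v e) (inverse_mat ((2 * h) \<cdot>\<^sub>m I) *\<^sub>v (S *\<^sub>v e)) =
      1 / (2 * h) * (\<Sum>i<d. (whiten y i - (1 - h * l i) * whiten x i)\<^sup>2)"
  proof -
    have "scalar_prod (S *\<^sub>v e) (inverse_mat ((2 * h) \<cdot>\<^sub>m I) *\<^sub>v (S *\<^sub>v e)) = 1 / (2 * h) * scalar_prod (S *\<^sub>v e) (R *\<^sub>v e)"
      using S R e h unfolding inv
      by (subst smult_mat_mult_vec[of _ d d]) (auto simp: assoc_mult_mat_vec[of _ d d _ d] R_S_vec)
    also have "scalar_prod (S *\<^sub>v e) (R *\<^sub>v e) = scalar_prod e e"
      using S R e by (subst S_scalar_prod) (auto simp: S_R_vec)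
    also have "\<dots> = (\<Sum>i<d. (whiten y i - (1 - h * l i) * whiten x i)\<^sup>2)"
      using e by (subst scalar_prod_sum[of _ d]) (auto simp: e_index power2_eq_square)
    finally show ?thesis .
  qed
  have det: "Determinant.det ((2 * h) \<cdot>\<^sub>m I) = (2 * h) ^ d * (Determinant.det S)\<^sup>2"
    using S I by (simp add: S_S[symmetric] det_mult[of _ d] power2_eq_square)
  have "mala_proposal d I J h x y =
      exp (- (1 / 2) * (1 / (2 * h) * (\<Sum>i<d. (whiten y i - (1 - h * l i) * whiten x i)\<^sup>2))) /
      sqrt ((2 * pi) ^ d * ((2 * h) ^ d * (Determinant.det S)\<^sup>2))"
    unfolding mala_proposal_def gauss_density_def Let_def z q det ..
  also have "exp (- (1 / 2) * (1 / (2 * h) * (\<Sum>i<d. (whiten y i - (1 - h * l i) * whiten x i)\<^sup>2)))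
      = (\<Prod>i<d. exp (- ((whiten y i - (1 - h * l i) * whiten x i)\<^sup>2 / (4 * h))))"
    by (simp add: exp_sum[symmetric] sum_negf sum_divide_distrib)
  also have "sqrt ((2 * pi) ^ d * ((2 * h) ^ d * (Determinant.det S)\<^sup>2)) =
      (\<Prod>i<d. sqrt (4 * pi * h)) * \<bar>Determinant.det S\<bar>"
  proof -
    have "(2 * pi) ^ d * ((2 * h) ^ d * (Determinant.det S)\<^sup>2) = (2 * pi * (2 * h)) ^ d * (Determinant.det S)\<^sup>2"
      by (simp only: power_mult_distrib mult.assoc)
    also have "2 * pi * (2 * h) = 4 * pi * h" by simp
    finally have "sqrt ((2 * pi) ^ d * ((2 * h) ^ d * (Determinant.det S)\<^sup>2)) =
        sqrt ((4 * pi * h) ^ d * (Determinant.det S)\<^sup>2)" by simp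
    also have "\<dots> = sqrt (4 * pi * h) ^ d * \<bar>Determinant.det S\<bar>"
      by (simp only: real_sqrt_mult[of "_ ^ d"] real_sqrt_power[of _ d] real_sqrt_abs)
    finally show ?thesis by simp
  qed
  also have "(\<Prod>i<d. exp (- ((whiten y i - (1 - h * l i) * whiten x i)\<^sup>2 / (4 * h)))) /
      ((\<Prod>i<d. sqrt (4 * pi * h)) * \<bar>Determinant.det S\<bar>) =
      (\<Prod>i<d. coord_proposal h (l i) (whiten x i) (whiten y i)) / \<bar>Determinant.det S\<bar>"
  proof -
    have "coord_proposal h c u v = exp (- ((v - (1 - h * c) * u)\<^sup>2 / (4 * h))) / sqrt (4 * pi * h)" for c u v
      using h by (simp add: coord_proposal_def normal_density_def mult_ac)
    then show ?thesis by (simp only: prod_dividef divide_divide_eq_left)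
  qed
  finally show ?thesis .
qed

end

section \<open>Dirichlet form of the slow coordinate\<close>

context gaussian_mala
begin

abbreviation (input) p :: "(nat \<Rightarrow> real) \<Rightarrow> real" where "p \<equiv> target_density d J"
abbreviation (input) q :: "(nat \<Rightarrow> real) \<Rightarrow> (nat \<Rightarrow> real) \<Rightarrow> real" where "q \<equiv> mala_proposal d I J h"

lemma whiten_component_measurable:
  "i < d \<Longrightarrow> (\<lambda>x. whiten x i) \<in> borel_measurable (lebesgue_Rn d)"
  using measurable_compose[OF whiten_measurable measurable_component_singleton[of i "{..<d}" "\<lambda>_. lborel"]]
  by simp

lemma whiten_fst_measurable:
  "i < d \<Longrightarrow> (\<lambda>z. whiten (fst z) i) \<in> borel_measurable (lebesgue_Rn d \<Otimes>\<^sub>M lebesgue_Rn d)"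
  and whiten_snd_measurable:
  "i < d \<Longrightarrow> (\<lambda>z. whiten (snd z) i) \<in> borel_measurable (lebesgue_Rn d \<Otimes>\<^sub>M lebesgue_Rn d)"
  using whiten_component_measurable[of i] by (auto intro: measurable_compose[OF measurable_fst] measurable_compose[OF measurable_snd])

lemma nn_integral_whiten_prod:
  assumes [measurable]: "\<And>i. i < d \<Longrightarrow> F i \<in> borel_measurable borel"
  shows "(\<integral>\<^sup>+x. (\<Prod>i<d. F i (whiten x i)) \<partial>lebesgue_Rn d) =
    ennreal \<bar>Determinant.det S\<bar> * (\<Prod>i<d. \<integral>\<^sup>+t. F i t \<partial>lborel)"
proof -
  have "(\<lambda>u. \<Prod>i<d. F i (u i)) \<in> borel_measurable (lebesgue_Rn d)"
    by (intro borel_measurable_prod_ennreal measurable_compose[OF measurable_component_singleton]) auto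
  then have "(\<integral>\<^sup>+x. (\<Prod>i<d. F i (whiten x i)) \<partial>lebesgue_Rn d) =
    ennreal \<bar>Determinant.det S\<bar> * (\<integral>\<^sup>+u. (\<Prod>i<d. F i (u i)) \<partial>lebesgue_Rn d)"
    by (rule nn_integral_whiten)
  also have "(\<integral>\<^sup>+u. (\<Prod>i<d. F i (u i)) \<partial>lebesgue_Rn d) = (\<Prod>i<d. \<integral>\<^sup>+t. F i t \<partial>lborel)"
    by (rule lborel_prod.product_nn_integral_prod) auto
  finally show ?thesis .
qed

lemma nn_integral_whiten_prod2:
  assumes F: "\<And>i. i < d \<Longrightarrow> (\<lambda>z. F i (fst z) (snd z)) \<in> borel_measurable (borel \<Otimes>\<^sub>M borel)"
  shows "(\<integral>\<^sup>+x. \<integral>\<^sup>+y. (\<Prod>i<d. F i (whiten x i) (whiten y i)) \<partial>lebesgue_Rn d \<partial>lebesgue_Rn d) =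
    ennreal ((Determinant.det S)\<^sup>2) * (\<Prod>i<d. \<integral>\<^sup>+u. \<integral>\<^sup>+v. F i u v \<partial>lborel \<partial>lborel)"
proof -
  let ?D = "ennreal \<bar>Determinant.det S\<bar>"
  have F1: "F i u \<in> borel_measurable borel" if "i < d" for i u
    using measurable_compose[OF measurable_Pair1'[of u borel borel] F[OF that]] by simp
  have F2: "(\<lambda>u. \<integral>\<^sup>+v. F i u v \<partial>lborel) \<in> borel_measurable borel" if "i < d" for i
    using F[OF that] by (intro lborel.borel_measurable_nn_integral) (simp add: case_prod_beta' cong: measurable_cong_sets)
  have "(\<integral>\<^sup>+x. \<integral>\<^sup>+y. (\<Prod>i<d. F i (whiten x i) (whiten y i)) \<partial>lebesgue_Rn d \<partial>lebesgue_Rn d) =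
      (\<integral>\<^sup>+x. ?D * (\<Prod>i<d. \<integral>\<^sup>+v. F i (whiten x i) v \<partial>lborel) \<partial>lebesgue_Rn d)"
    by (intro nn_integral_cong nn_integral_whiten_prod F1)
  also have "\<dots> = ?D * (\<integral>\<^sup>+x. (\<Prod>i<d. \<integral>\<^sup>+v. F i (whiten x i) v \<partial>lborel) \<partial>lebesgue_Rn d)"
    by (intro nn_integral_cmult borel_measurable_prod_ennreal measurable_compose[OF whiten_component_measurable F2]) auto
  also have "\<dots> = ?D * (?D * (\<Prod>i<d. \<integral>\<^sup>+u. \<integral>\<^sup>+v. F i u v \<partial>lborel \<partial>lborel))"
    by (subst nn_integral_whiten_prod[of "\<lambda>i u. \<integral>\<^sup>+v. F i u v \<partial>lborel"]) (auto simp: F2)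
  also have "\<dots> = ennreal ((Determinant.det S)\<^sup>2) * (\<Prod>i<d. \<integral>\<^sup>+u. \<integral>\<^sup>+v. F i u v \<partial>lborel \<partial>lborel)"
    by (simp add: power2_eq_square mult.assoc flip: ennreal_mult)
      (simp flip: mult.assoc ennreal_mult)
  finally show ?thesis .
qed

lemma ennreal_prod_over_det:
  assumes "\<And>i. i < d \<Longrightarrow> 0 \<le> f i" "0 < c"
  shows "ennreal ((\<Prod>i<d. f i) / c) = ennreal (1 / c) * (\<Prod>i<d. ennreal (f i))"
proof -
  have "ennreal ((\<Prod>i<d. f i) / c) = ennreal (1 / c * (\<Prod>i<d. f i))" by simp
  also have "\<dots> = ennreal (1 / c) * ennreal (\<Prod>i<d. f i)"
    using assms by (intro ennreal_mult prod_nonneg) auto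
  also have "ennreal (\<Prod>i<d. f i) = (\<Prod>i<d. ennreal (f i))"
    using assms by (intro prod_ennreal[symmetric]) auto
  finally show ?thesis .
qed

lemma nn_integral_whiten_density:
  assumes f: "\<And>i. i < d \<Longrightarrow> f i \<in> borel_measurable borel" "\<And>i t. i < d \<Longrightarrow> 0 \<le> f i t"
  shows "(\<integral>\<^sup>+x. ennreal ((\<Prod>i<d. f i (whiten x i)) / \<bar>Determinant.det S\<bar>) \<partial>lebesgue_Rn d) =
    (\<Prod>i<d. \<integral>\<^sup>+t. ennreal (f i t) \<partial>lborel)"
proof -
  have "(\<integral>\<^sup>+x. ennreal ((\<Prod>i<d. f i (whiten x i)) / \<bar>Determinant.det S\<bar>) \<partial>lebesgue_Rn d) =
      (\<integral>\<^sup>+x. ennreal (1 / \<bar>Determinant.det S\<bar>) * (\<Prod>i<d. ennreal (f i (whiten x i))) \<partial>lebesgue_Rn d)"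
    using f(2) det_S by (intro nn_integral_cong ennreal_prod_over_det) auto
  also have "\<dots> = ennreal (1 / \<bar>Determinant.det S\<bar>) * (\<integral>\<^sup>+x. (\<Prod>i<d. ennreal (f i (whiten x i))) \<partial>lebesgue_Rn d)"
    using f(1) by (intro nn_integral_cmult borel_measurable_prod_ennreal measurable_compose[OF _ measurable_ennreal]
        measurable_compose[OF whiten_component_measurable]) auto
  also have "\<dots> = ennreal (1 / \<bar>Determinant.det S\<bar>) * (ennreal \<bar>Determinant.det S\<bar> * (\<Prod>i<d. \<integral>\<^sup>+t. ennreal (f i t) \<partial>lborel))"
    using f(1) by (subst nn_integral_whiten_prod[of "\<lambda>i t. ennreal (f i t)"]) auto
  also have "\<dots> = (\<Prod>i<d. \<integral>\<^sup>+t. ennreal (f i t) \<partial>lborel)"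
    using det_S by (simp flip: mult.assoc ennreal_mult)
  finally show ?thesis .
qed

text \<open>The form in which both Dirichlet bounds use whitening: the two Jacobians cancel the
  squared determinant, and an integral over pairs of points splits into planar integrals, one for
  each coordinate.\<close>

lemma nn_integral_whiten_density2:
  assumes f: "\<And>i. i < d \<Longrightarrow> (\<lambda>z. f i (fst z) (snd z)) \<in> borel_measurable (borel \<Otimes>\<^sub>M borel)"
    "\<And>i u v. i < d \<Longrightarrow> 0 \<le> f i u v"
  shows "(\<integral>\<^sup>+x. \<integral>\<^sup>+y. ennreal ((\<Prod>i<d. f i (whiten x i) (whiten y i)) / (Determinant.det S)\<^sup>2)
      \<partial>lebesgue_Rn d \<partial>lebesgue_Rn d) =
    (\<Prod>i<d. \<integral>\<^sup>+u. \<integral>\<^sup>+v. ennreal (f i u v) \<partial>lborel \<partial>lborel)"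
proof -
  let ?c = "ennreal (1 / (Determinant.det S)\<^sup>2)"
  have f1: "f i u \<in> borel_measurable borel" if "i < d" for i u
    using measurable_compose[OF measurable_Pair1'[of u borel borel] f(1)[OF that]] by simp
  have f2: "(\<lambda>z. f i (whiten (fst z) i) (whiten (snd z) i)) \<in> borel_measurable (lebesgue_Rn d \<Otimes>\<^sub>M lebesgue_Rn d)"
    if "i < d" for i
  proof -
    note [measurable] = whiten_component_measurable[OF that]
    have "(\<lambda>z. (whiten (fst z) i, whiten (snd z) i)) \<in> lebesgue_Rn d \<Otimes>\<^sub>M lebesgue_Rn d \<rightarrow>\<^sub>M borel \<Otimes>\<^sub>M borel"
      by measurable
    from measurable_compose[OF this f(1)[OF that]] show ?thesis by simp
  qed
  interpret Rd: sigma_finite_measure "lebesgue_Rn d"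
    by (rule lborel_prod.sigma_finite) simp
  have prod: "(\<lambda>z. \<Prod>i<d. ennreal (f i (whiten (fst z) i) (whiten (snd z) i)))
      \<in> borel_measurable (lebesgue_Rn d \<Otimes>\<^sub>M lebesgue_Rn d)"
    by (intro borel_measurable_prod_ennreal measurable_compose[OF f2 measurable_ennreal]) auto
  have "(\<integral>\<^sup>+x. \<integral>\<^sup>+y. ennreal ((\<Prod>i<d. f i (whiten x i) (whiten y i)) / (Determinant.det S)\<^sup>2)
      \<partial>lebesgue_Rn d \<partial>lebesgue_Rn d) =
     (\<integral>\<^sup>+x. \<integral>\<^sup>+y. ?c * (\<Prod>i<d. ennreal (f i (whiten x i) (whiten y i))) \<partial>lebesgue_Rn d \<partial>lebesgue_Rn d)"
    using f(2) det_S by (intro nn_integral_cong ennreal_prod_over_det) auto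
  also have "\<dots> = (\<integral>\<^sup>+x. ?c * (\<integral>\<^sup>+y. (\<Prod>i<d. ennreal (f i (whiten x i) (whiten y i))) \<partial>lebesgue_Rn d) \<partial>lebesgue_Rn d)"
    using f1 by (intro nn_integral_cong nn_integral_cmult borel_measurable_prod_ennreal
        measurable_compose[OF _ measurable_ennreal] measurable_compose[OF whiten_component_measurable]) auto
  also have "\<dots> = ?c * (\<integral>\<^sup>+x. \<integral>\<^sup>+y. (\<Prod>i<d. ennreal (f i (whiten x i) (whiten y i))) \<partial>lebesgue_Rn d \<partial>lebesgue_Rn d)"
    using prod by (intro nn_integral_cmult Rd.borel_measurable_nn_integral) (simp add: case_prod_beta')
  also have "\<dots> = ?c * (ennreal ((Determinant.det S)\<^sup>2) * (\<Prod>i<d. \<integral>\<^sup>+u. \<integral>\<^sup>+v. ennreal (f i u v) \<partial>lborel \<partial>lborel))"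
    using f(1) by (subst nn_integral_whiten_prod2[of "\<lambda>i u v. ennreal (f i u v)"]) auto
  also have "\<dots> = (\<Prod>i<d. \<integral>\<^sup>+u. \<integral>\<^sup>+v. ennreal (f i u v) \<partial>lborel \<partial>lborel)"
    using det_S by (simp flip: mult.assoc ennreal_mult)
  finally show ?thesis .
qed

lemma p_measurable: "p \<in> borel_measurable (lebesgue_Rn d)"
proof -
  have "(\<lambda>x. coord_target (l i) (whiten x i)) \<in> borel_measurable (lebesgue_Rn d)" if "i < d" for i
    by (rule measurable_compose[OF whiten_component_measurable[OF that] coord_target_measurable])
  then show ?thesis
    unfolding target_density_eq by (intro borel_measurable_divide borel_measurable_prod) auto
qed

lemma q_measurable: "case_prod q \<in> borel_measurable (lebesgue_Rn d \<Otimes>\<^sub>M lebesgue_Rn d)"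
proof -
  have "(\<lambda>z. coord_proposal h (l i) (whiten (fst z) i) (whiten (snd z) i))
      \<in> borel_measurable (lebesgue_Rn d \<Otimes>\<^sub>M lebesgue_Rn d)" if "i < d" for i
    by (rule coord_proposal_measurable[OF whiten_fst_measurable[OF that] whiten_snd_measurable[OF that]])
  then show ?thesis
    unfolding proposal_eq case_prod_beta'
    by (intro borel_measurable_divide borel_measurable_prod) auto
qed

sublocale mh: metropolis "lebesgue_Rn d" p q "1 / 2"
proof (intro metropolis.intro metropolis_axioms.intro)
  show "sigma_finite_measure (lebesgue_Rn d)" by (rule lborel_prod.sigma_finite) simp
  show "0 < p x" for x
    using det_S l_pos unfolding target_density_eq by (intro divide_pos_pos prod_pos) (auto simp: coord_target_pos)
  show "0 < q x y" for x y
    using det_S h unfolding proposal_eq by (intro divide_pos_pos prod_pos) (auto simp: coord_proposal_pos)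
  show "p \<in> borel_measurable (lebesgue_Rn d)" by (rule p_measurable)
  show "case_prod q \<in> borel_measurable (lebesgue_Rn d \<Otimes>\<^sub>M lebesgue_Rn d)" by (rule q_measurable)
  show "(\<integral>\<^sup>+x. ennreal (p x) \<partial>lebesgue_Rn d) = 1"
    unfolding target_density_eq
    by (subst nn_integral_whiten_density) (auto simp: l_pos coord_target_pos less_imp_le nn_integral_coord_target)
  show "(\<integral>\<^sup>+y. ennreal (q x y) \<partial>lebesgue_Rn d) = 1" for x
    unfolding proposal_eq
    by (subst nn_integral_whiten_density) (auto simp: coord_proposal_pos[OF h] less_imp_le nn_integral_coord_proposal[OF h])
qed auto

lemma p_q_eq:
  "p x * q x y = (\<Prod>i<d. coord_target (l i) (whiten x i) * coord_proposal h (l i) (whiten x i) (whiten y i)) / (Determinant.det S)\<^sup>2"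
  by (simp add: target_density_eq proposal_eq prod.distrib power2_eq_square flip: abs_mult)

lemma coord_joint_nonneg: "i < d \<Longrightarrow> 0 \<le> coord_target (l i) u * coord_proposal h (l i) u v"
  using coord_target_pos[OF l_pos] coord_proposal_pos[OF h] by (simp add: less_imp_le)

section \<open>The slow coordinate and the test function\<close>

definition slow :: "(nat \<Rightarrow> real) \<Rightarrow> real" where
  "slow x = sqrt (l (d - 1)) * whiten x (d - 1)"

context
  assumes d: "0 < d"
begin

lemma slow_measurable [measurable]: "slow \<in> borel_measurable (lebesgue_Rn d)"
  unfolding slow_def using d by (intro borel_measurable_times whiten_component_measurable) auto

text \<open>All factors but the last integrate to 1; in the last one a scaling turns the Gaussian of
  precision \<open>l (d - 1)\<close> into a standard one.\<close>

lemma slow_std_normal: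
  assumes [measurable]: "F \<in> borel_measurable borel"
  shows "(\<integral>\<^sup>+x. ennreal (p x) * F (slow x) \<partial>lebesgue_Rn d) = (\<integral>\<^sup>+t. ennreal (std_normal_density t) * F t \<partial>lborel)"
proof -
  let ?l = "l (d - 1)"
  let ?G = "\<lambda>i t. ennreal (coord_target (l i) t) * (if i = d - 1 then F (sqrt ?l * t) else 1)"
  have l: "0 < ?l" using d by (intro l_pos) simp
  have "(\<integral>\<^sup>+x. ennreal (p x) * F (slow x) \<partial>lebesgue_Rn d) =
     (\<integral>\<^sup>+x. ennreal (1 / \<bar>Determinant.det S\<bar>) * (\<Prod>i<d. ?G i (whiten x i)) \<partial>lebesgue_Rn d)"
  proof (intro nn_integral_cong)
    fix x
    have "ennreal (p x) = ennreal (1 / \<bar>Determinant.det S\<bar>) * (\<Prod>i<d. ennreal (coord_target (l i) (whiten x i)))"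
      unfolding target_density_eq using det_S l_pos
      by (intro ennreal_prod_over_det) (auto simp: coord_target_pos less_imp_le)
    moreover have "(\<Prod>i<d. if i = d - 1 then F (sqrt ?l * whiten x i) else 1) = F (slow x)"
      using d by (simp add: slow_def)
    ultimately show "ennreal (p x) * F (slow x) = ennreal (1 / \<bar>Determinant.det S\<bar>) * (\<Prod>i<d. ?G i (whiten x i))"
      by (simp add: prod.distrib mult.assoc)
  qed
  also have "\<dots> = ennreal (1 / \<bar>Determinant.det S\<bar>) * (\<integral>\<^sup>+x. (\<Prod>i<d. ?G i (whiten x i)) \<partial>lebesgue_Rn d)"
    by (intro nn_integral_cmult borel_measurable_prod_ennreal measurable_compose[OF whiten_component_measurable, where g = "?G _"]) auto
  also have "\<dots> = ennreal (1 / \<bar>Determinant.det S\<bar>) * (ennreal \<bar>Determinant.det S\<bar> * (\<Prod>i<d. \<integral>\<^sup>+t. ?G i t \<partial>lborel))"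
    by (subst nn_integral_whiten_prod[of ?G]) auto
  also have "\<dots> = (\<Prod>i<d. \<integral>\<^sup>+t. ?G i t \<partial>lborel)"
    using det_S by (simp flip: mult.assoc ennreal_mult)
  also have "\<dots> = (\<Prod>i<d. if i = d - 1 then \<integral>\<^sup>+t. ennreal (coord_target ?l t) * F (sqrt ?l * t) \<partial>lborel else 1)"
    by (intro prod.cong) (auto simp: nn_integral_coord_target l_pos)
  also have "\<dots> = (\<integral>\<^sup>+t. ennreal (coord_target ?l t) * F (sqrt ?l * t) \<partial>lborel)"
    using d by simp
  also have "\<dots> = (\<integral>\<^sup>+t. ennreal (sqrt ?l) * (ennreal (std_normal_density (sqrt ?l * t)) * F (sqrt ?l * t)) \<partial>lborel)"
  proof (intro nn_integral_cong)
    fix t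
    have "coord_target ?l t = sqrt ?l * std_normal_density (sqrt ?l * t)"
      using l by (simp add: coord_target_def normal_density_def power_divide real_sqrt_divide power_mult_distrib mult_ac)
    then show "ennreal (coord_target ?l t) * F (sqrt ?l * t) =
        ennreal (sqrt ?l) * (ennreal (std_normal_density (sqrt ?l * t)) * F (sqrt ?l * t))"
      using l by (simp add: ennreal_mult mult.assoc)
  qed
  also have "\<dots> = ennreal (sqrt ?l) * (\<integral>\<^sup>+t. ennreal (std_normal_density (sqrt ?l * t)) * F (sqrt ?l * t) \<partial>lborel)"
    by (rule nn_integral_cmult) measurable
  also have "\<dots> = (\<integral>\<^sup>+t. ennreal (std_normal_density t) * F t \<partial>lborel)"
    using nn_integral_real_affine[of "\<lambda>t. ennreal (std_normal_density t) * F t" "sqrt ?l" 0] l by simp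
  finally show ?thesis .
qed

text \<open>The identity for nonnegative integrands is read as equality of image measures. Integrals
  of functions of either sign then transfer without a discussion of integrability.\<close>

lemma integral_slow:
  assumes [measurable]: "f \<in> borel_measurable borel"
  shows "(\<integral>x. p x * f (slow x) \<partial>lebesgue_Rn d) = (\<integral>t. std_normal_density t * f t \<partial>lborel)"
proof -
  note [measurable] = p_measurable
  have "distr (density (lebesgue_Rn d) (\<lambda>x. ennreal (p x))) borel slow = density lborel (\<lambda>t. ennreal (std_normal_density t))"
  proof (rule measure_eqI)
    fix E assume "E \<in> sets (distr (density (lebesgue_Rn d) (\<lambda>x. ennreal (p x))) borel slow)"
    then have [measurable]: "E \<in> sets borel" by simp
    have "emeasure (distr (density (lebesgue_Rn d) (\<lambda>x. ennreal (p x))) borel slow) E =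
        (\<integral>\<^sup>+t. indicator E t \<partial>distr (density (lebesgue_Rn d) (\<lambda>x. ennreal (p x))) borel slow)"
      by simp
    also have "\<dots> = (\<integral>\<^sup>+x. indicator E (slow x) \<partial>density (lebesgue_Rn d) (\<lambda>x. ennreal (p x)))"
      by (rule nn_integral_distr) measurable
    also have "\<dots> = (\<integral>\<^sup>+x. ennreal (p x) * indicator E (slow x) \<partial>lebesgue_Rn d)"
      by (rule nn_integral_density) measurable
    also have "\<dots> = (\<integral>\<^sup>+t. ennreal (std_normal_density t) * indicator E t \<partial>lborel)"
      by (rule slow_std_normal) measurable
    also have "\<dots> = emeasure (density lborel (\<lambda>t. ennreal (std_normal_density t))) E"
      by (rule emeasure_density[symmetric]) auto
    finally show "emeasure (distr (density (lebesgue_Rn d) (\<lambda>x. ennreal (p x))) borel slow) E =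
        emeasure (density lborel (\<lambda>t. ennreal (std_normal_density t))) E" .
  qed simp
  note eq = this
  have "(\<integral>x. p x * f (slow x) \<partial>lebesgue_Rn d) = (\<integral>x. f (slow x) \<partial>density (lebesgue_Rn d) (\<lambda>x. ennreal (p x)))"
    using mh.p_pos by (subst integral_density) (auto simp: less_imp_le)
  also have "\<dots> = (\<integral>t. f t \<partial>distr (density (lebesgue_Rn d) (\<lambda>x. ennreal (p x))) borel slow)"
    by (rule integral_distr[symmetric]) auto
  also have "\<dots> = (\<integral>t. std_normal_density t * f t \<partial>lborel)"
    unfolding eq by (subst integral_density) auto
  finally show ?thesis .
qed

text \<open>Under the target \<open>slow\<close> is standard normal, so the truncation acts at unit
  scale and the variance of \<open>test\<close> depends on no parameter of the chain.\<close>

definition test :: "(nat \<Rightarrow> real) \<Rightarrow> real" where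
  "test x = clamp1 (slow x)"

lemma test_measurable [measurable]: "test \<in> borel_measurable (lebesgue_Rn d)"
  unfolding test_def[abs_def] by measurable

lemma test_bounded: "mh.bounded_by 1 test"
  using clamp1_bound test_measurable by (auto simp: mh.bounded_by_def test_def)

lemma test_mean: "(\<integral>x. p x * test x \<partial>lebesgue_Rn d) = 0"
  unfolding test_def by (simp add: integral_slow integral_std_normal_clamp1)

lemma test_variance: "mh.ip test test = clamp_variance"
  unfolding test_def mh.ip_def clamp_variance_def
  by (rule integral_slow[of "\<lambda>t. clamp1 t * clamp1 t"]) measurable

text \<open>Rejections are dropped by \<open>mh.r x y \<le> q x y\<close>, and truncation is a
  contraction. In the remaining product integral only the last coordinate carries a jump; the other
  factors are joint densities of mass 1.\<close>

lemma pair_form_jump_bound: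
  "mh.pair_form (\<lambda>z. (test (fst z) - test (snd z))\<^sup>2) \<le> 2 * (h * l (d - 1)) + (h * l (d - 1))\<^sup>2"
proof (rule mh.pair_form_le)
  let ?l = "l (d - 1)"
  have l: "0 < ?l" using d by (intro l_pos) simp
  show "(\<lambda>z. (test (fst z) - test (snd z))\<^sup>2) \<in> borel_measurable (lebesgue_Rn d \<Otimes>\<^sub>M lebesgue_Rn d)"
    by measurable
  let ?f = "\<lambda>i u v. coord_target (l i) u * coord_proposal h (l i) u v * (if i = d - 1 then ?l * (u - v)\<^sup>2 else 1)"
  have "(\<integral>\<^sup>+x. \<integral>\<^sup>+y. ennreal (p x * mh.r x y * (test (fst (x, y)) - test (snd (x, y)))\<^sup>2) \<partial>lebesgue_Rn d \<partial>lebesgue_Rn d)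
     \<le> (\<integral>\<^sup>+x. \<integral>\<^sup>+y. ennreal ((\<Prod>i<d. ?f i (whiten x i) (whiten y i)) / (Determinant.det S)\<^sup>2) \<partial>lebesgue_Rn d \<partial>lebesgue_Rn d)"
  proof (intro nn_integral_mono ennreal_leI)
    fix x y assume x: "x \<in> space (lebesgue_Rn d)" and y: "y \<in> space (lebesgue_Rn d)"
    have "(test x - test y)\<^sup>2 \<le> ?l * (whiten x (d - 1) - whiten y (d - 1))\<^sup>2"
      using clamp1_lipschitz[of "slow x" "slow y"] l
      by (simp add: test_def slow_def power_mult_distrib flip: right_diff_distrib)
    moreover have "p x * mh.r x y \<le> p x * q x y"
      using mh.r_bounds[OF x y] mh.p_pos[OF x] by (simp add: mult_left_mono)
    ultimately have "p x * mh.r x y * (test x - test y)\<^sup>2 \<le> p x * q x y * (?l * (whiten x (d - 1) - whiten y (d - 1))\<^sup>2)"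
      using mh.p_pos[OF x] mh.q_pos[OF x y] mh.r_bounds[OF x y] by (intro mult_mono) auto
    also have "\<dots> = (\<Prod>i<d. ?f i (whiten x i) (whiten y i)) / (Determinant.det S)\<^sup>2"
      using d by (simp add: p_q_eq prod.distrib)
    finally show "p x * mh.r x y * (test (fst (x, y)) - test (snd (x, y)))\<^sup>2 \<le>
        (\<Prod>i<d. ?f i (whiten x i) (whiten y i)) / (Determinant.det S)\<^sup>2" by simp
  qed
  also have "\<dots> = (\<Prod>i<d. \<integral>\<^sup>+u. \<integral>\<^sup>+v. ennreal (?f i u v) \<partial>lborel \<partial>lborel)"
  proof (rule nn_integral_whiten_density2)
    show "(\<lambda>z. ?f i (fst z) (snd z)) \<in> borel_measurable (borel \<Otimes>\<^sub>M borel)" for i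
      by measurable
    show "0 \<le> ?f i u v" if "i < d" for i u v
      using coord_joint_nonneg[OF that, of u v] l by simp
  qed
  also have "\<dots> = (\<Prod>i<d. if i = d - 1 then ennreal (2 * (h * ?l) + (h * ?l)\<^sup>2) else 1)"
    using nn_integral_coord_jump[OF l h] nn_integral_coord_joint[OF l_pos h] by (intro prod.cong) auto
  also have "\<dots> = ennreal (2 * (h * ?l) + (h * ?l)\<^sup>2)"
    using d by simp
  finally show "(\<integral>\<^sup>+x. \<integral>\<^sup>+y. ennreal (p x * mh.r x y * (test (fst (x, y)) - test (snd (x, y)))\<^sup>2) \<partial>lebesgue_Rn d \<partial>lebesgue_Rn d)
     \<le> ennreal (2 * (h * ?l) + (h * ?l)\<^sup>2)" .
  show "0 \<le> 2 * (h * ?l) + (h * ?l)\<^sup>2" using l h by simp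
qed auto

lemma sqrt_p_q:
  "sqrt (p x * q x y * (p y * q y x)) =
    (\<Prod>i<d. sqrt (coord_target (l i) (whiten x i) * coord_proposal h (l i) (whiten x i) (whiten y i) *
      (coord_target (l i) (whiten y i) * coord_proposal h (l i) (whiten y i) (whiten x i)))) / (Determinant.det S)\<^sup>2"
proof -
  have "sqrt (a / c * (b / c)) = sqrt (a * b) / c" if "0 < c" for a b c :: real
    using that by (simp add: real_sqrt_divide real_sqrt_mult)
  note * = this[of "(Determinant.det S)\<^sup>2"]
  have "0 < (Determinant.det S)\<^sup>2" using det_S by simp
  then show ?thesis
    unfolding p_q_eq by (simp only: * prod.distrib[symmetric] sqrt_prod)
qed

text \<open>The accepted flow is a minimum of two joint densities, hence at most their geometric
  mean, which factors over coordinates although the minimum does not. The 4 is the square of 2, the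
  largest possible difference of two values of \<open>test\<close>.\<close>

lemma pair_form_affinity_bound:
  "mh.pair_form (\<lambda>z. (test (fst z) - test (snd z))\<^sup>2) \<le> 4 * (\<Prod>i<d. 1 / sqrt (1 + (h * l i) ^ 3 / 8))"
proof (rule mh.pair_form_le)
  show "(\<lambda>z. (test (fst z) - test (snd z))\<^sup>2) \<in> borel_measurable (lebesgue_Rn d \<Otimes>\<^sub>M lebesgue_Rn d)"
    by measurable
  let ?K = "\<lambda>x y. sqrt (p x * q x y * (p y * q y x))"
  let ?f = "\<lambda>i u v. sqrt (coord_target (l i) u * coord_proposal h (l i) u v * (coord_target (l i) v * coord_proposal h (l i) v u))"
  have "(\<integral>\<^sup>+x. \<integral>\<^sup>+y. ennreal (p x * mh.r x y * (test (fst (x, y)) - test (snd (x, y)))\<^sup>2) \<partial>lebesgue_Rn d \<partial>lebesgue_Rn d)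
     \<le> (\<integral>\<^sup>+x. \<integral>\<^sup>+y. 4 * ennreal (?K x y) \<partial>lebesgue_Rn d \<partial>lebesgue_Rn d)"
  proof (intro nn_integral_mono)
    fix x y assume x: "x \<in> space (lebesgue_Rn d)" and y: "y \<in> space (lebesgue_Rn d)"
    let ?a = "p x * q x y" and ?b = "p y * q y x"
    have ab: "0 \<le> ?a" "0 \<le> ?b" using mh.p_pos mh.q_pos x y by (auto simp: less_imp_le)
    have "\<bar>test x - test y\<bar> \<le> 2"
      using clamp1_bound[of "slow x"] clamp1_bound[of "slow y"] unfolding test_def by linarith
    then have "(test x - test y)\<^sup>2 \<le> 2\<^sup>2" by (subst abs_le_square_iff[symmetric]) simp
    then have t: "(test x - test y)\<^sup>2 \<le> 4" by simp
    have "min ?a ?b = sqrt (min ?a ?b * min ?a ?b)" using ab by simp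
    also have "\<dots> \<le> ?K x y"
      using ab by (intro real_sqrt_le_mono mult_mono) auto
    finally have "p x * mh.r x y \<le> ?K x y"
      using mh.p_r_eq_min[OF x y] by simp
    then have "p x * mh.r x y * (test x - test y)\<^sup>2 \<le> ?K x y * 4"
      using t ab by (intro mult_mono) auto
    then have "ennreal (p x * mh.r x y * (test x - test y)\<^sup>2) \<le> ennreal (4 * ?K x y)"
      by (intro ennreal_leI) (simp only: mult.commute)
    also have "\<dots> = 4 * ennreal (?K x y)"
      by (subst ennreal_mult') auto
    finally show "ennreal (p x * mh.r x y * (test (fst (x, y)) - test (snd (x, y)))\<^sup>2) \<le> 4 * ennreal (?K x y)"
      by (simp only: fst_conv snd_conv)
  qed
  also have "\<dots> = (\<integral>\<^sup>+x. 4 * (\<integral>\<^sup>+y. ennreal (?K x y) \<partial>lebesgue_Rn d) \<partial>lebesgue_Rn d)"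
    by (intro nn_integral_cong nn_integral_cmult) measurable
  also have "\<dots> = 4 * (\<integral>\<^sup>+x. \<integral>\<^sup>+y. ennreal (?K x y) \<partial>lebesgue_Rn d \<partial>lebesgue_Rn d)"
    by (intro nn_integral_cmult) measurable
  also have "(\<integral>\<^sup>+x. \<integral>\<^sup>+y. ennreal (?K x y) \<partial>lebesgue_Rn d \<partial>lebesgue_Rn d) = (\<Prod>i<d. \<integral>\<^sup>+u. \<integral>\<^sup>+v. ennreal (?f i u v) \<partial>lborel \<partial>lborel)"
    unfolding sqrt_p_q
  proof (rule nn_integral_whiten_density2)
    show "(\<lambda>z. ?f i (fst z) (snd z)) \<in> borel_measurable (borel \<Otimes>\<^sub>M borel)" for i
      by measurable
    show "0 \<le> ?f i u v" if "i < d" for i u v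
      using coord_joint_nonneg[OF that] by simp
  qed
  also have "\<dots> = (\<Prod>i<d. ennreal (1 / sqrt (1 + (h * l i) ^ 3 / 8)))"
    by (intro prod.cong) (auto simp: nn_integral_coord_affinity[OF l_pos h])
  also have "\<dots> = ennreal (\<Prod>i<d. 1 / sqrt (1 + (h * l i) ^ 3 / 8))"
    using h l_pos by (intro prod_ennreal) (auto simp: less_imp_le)
  also have "4 * ennreal (\<Prod>i<d. 1 / sqrt (1 + (h * l i) ^ 3 / 8)) = ennreal (4 * (\<Prod>i<d. 1 / sqrt (1 + (h * l i) ^ 3 / 8)))"
    by (simp add: ennreal_mult')
  finally show "(\<integral>\<^sup>+x. \<integral>\<^sup>+y. ennreal (p x * mh.r x y * (test (fst (x, y)) - test (snd (x, y)))\<^sup>2) \<partial>lebesgue_Rn d \<partial>lebesgue_Rn d)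
     \<le> ennreal (4 * (\<Prod>i<d. 1 / sqrt (1 + (h * l i) ^ 3 / 8)))" .
  show "0 \<le> 4 * (\<Prod>i<d. 1 / sqrt (1 + (h * l i) ^ 3 / 8))"
    using h l_pos by (intro mult_nonneg_nonneg prod_nonneg) (auto simp: less_imp_le)
qed auto

text \<open>The factor 4 reflects laziness: with holding probability 1/2 the Dirichlet form is a
  quarter of \<open>mh.pair_form\<close>, so \<open>G\<close> bounds the Dirichlet quotient of
  \<open>test\<close>. The inversion of the decay into a time is delegated to the hypothesis on
  \<open>X\<close>.\<close>

lemma mix_time_lower_bound:
  assumes G: "mh.pair_form (\<lambda>z. (test (fst z) - test (snd z))\<^sup>2) \<le> 4 * G * clamp_variance" "G \<le> 1"
    and M\<^sub>0: "2 \<le> M\<^sub>0" and \<epsilon>: "0 < \<epsilon>"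
    and X: "\<And>k. (1 - G) ^ (2 * k) * clamp_variance \<le> \<epsilon>\<^sup>2 \<Longrightarrow> X \<le> real k"
  shows "ereal X \<le> ereal_of_enat (mix_time (1 / 2) d I J h \<epsilon> M\<^sub>0)"
proof -
  define \<mu> where "\<mu> = mh.tilted (\<lambda>x. 1 + test x)"
  have target: "target d J = mh.target"
    by (simp add: target_def mh.target_def)
  have kernel: "lazy_mala_kernel (1 / 2) d I J h = mh.kernel"
    by (rule ext) (simp add: lazy_mala_kernel_def mh.kernel_def mh.a_def mh.r_def mh.accept_def mala_accept_def)
  have law: "lazy_mala_law (1 / 2) d I J h \<mu> k = mh.tilted (\<lambda>x. 1 + (mh.P ^^ k) test x)" for k
    unfolding lazy_mala_law_def kernel \<mu>_def by (rule mh.law_tilted[OF test_bounded])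
  have gap: "mh.ip test test - mh.ip test (mh.P test) \<le> G * mh.ip test test"
  proof -
    have "mh.ip test test - mh.ip test (mh.P test) = 1 / 4 * mh.pair_form (\<lambda>z. (test (fst z) - test (snd z))\<^sup>2)"
      using mh.dirichlet_form[OF test_bounded] by simp
    then show ?thesis using G(1) by (simp only: test_variance)
  qed
  have X': "X \<le> real k"
    if "ennsqrt (chi_square (lazy_mala_law (1 / 2) d I J h \<mu> k) (target d J)) \<le> ennreal \<epsilon>" for k
  proof (rule X)
    have "chi_square (lazy_mala_law (1 / 2) d I J h \<mu> k) (target d J) = ennreal (mh.ip ((mh.P ^^ k) test) ((mh.P ^^ k) test))"
      unfolding law target by (rule mh.chi_square_tilted[OF mh.bounded_by_P_iterate[OF test_bounded]])
    then have "sqrt (mh.ip ((mh.P ^^ k) test) ((mh.P ^^ k) test)) \<le> \<epsilon>"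
      using that \<epsilon> mh.ip_nonneg by (simp add: ennsqrt_def ennreal_le_iff)
    then have "mh.ip ((mh.P ^^ k) test) ((mh.P ^^ k) test) \<le> \<epsilon>\<^sup>2"
      by (rule sqrt_le_D)
    then show "(1 - G) ^ (2 * k) * clamp_variance \<le> \<epsilon>\<^sup>2"
      using mh.ip_P_iterate_lower[OF test_bounded gap G(2), of k] by (simp add: test_variance)
  qed
  have "warm_start M\<^sub>0 (target d J) \<mu>"
    unfolding target \<mu>_def by (rule mh.warm_start_tilted[OF test_bounded test_mean M\<^sub>0])
  then have "mix_time_from (1 / 2) d I J h \<epsilon> \<mu> \<le> mix_time (1 / 2) d I J h \<epsilon> M\<^sub>0"
    unfolding mix_time_def by (intro SUP_upper) simp
  \<comment> \<open>An infinite mixing time leaves nothing to show. A finite one is attained, since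
    a nonempty set of extended naturals contains its infimum.\<close>
  moreover have "ereal X \<le> ereal_of_enat (mix_time_from (1 / 2) d I J h \<epsilon> \<mu>)"
  proof (cases "mix_time_from (1 / 2) d I J h \<epsilon> \<mu>")
    case (enat m)
    let ?A = "enat ` {k. ennsqrt (chi_square (lazy_mala_law (1 / 2) d I J h \<mu> k) (target d J)) \<le> ennreal \<epsilon>}"
    have "Inf ?A = enat m" using enat by (simp add: mix_time_from_def)
    then have "?A \<noteq> {}" by (auto simp: Inf_enat_def split: if_splits)
    then have "Inf ?A \<in> ?A" unfolding Inf_enat_def by (auto intro: LeastI)
    then have "m \<in> {k. ennsqrt (chi_square (lazy_mala_law (1 / 2) d I J h \<mu> k) (target d J)) \<le> ennreal \<epsilon>}"
      unfolding \<open>Inf ?A = enat m\<close> by auto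
    then show ?thesis using X' enat by simp
  qed simp
  ultimately show ?thesis
    by (meson ereal_of_enat_le_iff order.trans)
qed

end

end

section \<open>Choice of the step size\<close>

text \<open>ln (1 - G) is at least - G - 2 G^2, hence at least - 2 G for G \<le> 1 / 2. The factor 2
  in the exponent cancels against the square of \<epsilon>, which leaves the rate 2 G per
  step.\<close>

lemma decay_time_lower_bound:
  fixes G c \<epsilon> :: real
  assumes G: "0 < G" "G \<le> 1 / 2" and c: "0 < c" and \<epsilon>: "0 < \<epsilon>"
    and le: "(1 - G) ^ (2 * k) * c \<le> \<epsilon>\<^sup>2"
  shows "ln (sqrt c / \<epsilon>) / (2 * G) \<le> real k"
proof -
  have "ln ((1 - G) ^ (2 * k) * c) \<le> ln (\<epsilon>\<^sup>2)"
    using le G c \<epsilon> by (subst ln_le_cancel_iff) auto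
  then have "2 * real k * ln (1 - G) + ln c \<le> 2 * ln \<epsilon>"
    using G c \<epsilon> by (simp add: ln_mult ln_realpow)
  moreover have "G * G \<le> G * (1 / 2)"
    using G by (intro mult_left_mono) auto
  then have "- 2 * G \<le> ln (1 - G)"
    using ln_one_minus_pos_lower_bound[of G] G unfolding power2_eq_square by linarith
  then have "2 * real k * (- 2 * G) \<le> 2 * real k * ln (1 - G)"
    by (intro mult_left_mono) auto
  ultimately have "ln c / 2 - ln \<epsilon> \<le> 2 * G * real k" by simp
  moreover have "ln (sqrt c / \<epsilon>) = ln c / 2 - ln \<epsilon>"
    using c \<epsilon> by (simp add: ln_div ln_sqrt)
  ultimately show ?thesis using G by (simp add: field_simps)
qed

text \<open>The constant 64 is 8 times 8. One 8 undoes the division in s^3 / 8; the other pays three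
  factors of 2: one for exp (w / 2) \<le> 1 + w, one for the square root, and one for
  \<open>d - 1\<close> in place of \<open>d\<close>.\<close>

lemma affinity_power_bound:
  fixes s L :: real
  assumes d: "2 \<le> d" and L: "0 \<le> L" "8 * L \<le> real d" and s: "64 * L / real d \<le> s ^ 3"
  shows "(1 / sqrt (1 + s ^ 3 / 8)) ^ (d - 1) \<le> exp (- L)"
proof -
  define w where "w = 8 * L / real d"
  have w: "0 \<le> w" "w \<le> 1" "w \<le> s ^ 3 / 8" using d L s by (auto simp: w_def field_simps)
  have "exp (w / 2) \<le> 1 + w / 2 + (w / 2)\<^sup>2" using w by (intro exp_bound) auto
  also have "(w / 2)\<^sup>2 \<le> w / 2"
    using w mult_left_mono[of "w / 2" 1 "w / 2"] by (simp add: power2_eq_square)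
  finally have "exp (w / 2) \<le> 1 + s ^ 3 / 8" using w by simp
  then have "sqrt (exp (w / 2)) \<le> sqrt (1 + s ^ 3 / 8)" by (rule real_sqrt_le_mono)
  moreover have "sqrt (exp (w / 2)) = exp (w / 4)"
    by (rule real_sqrt_unique) (auto simp flip: exp_double)
  ultimately have e: "exp (w / 4) \<le> sqrt (1 + s ^ 3 / 8)" by simp
  have "(1 / sqrt (1 + s ^ 3 / 8)) ^ (d - 1) \<le> exp (- (w / 4)) ^ (d - 1)"
    using e order.strict_trans2[OF exp_gt_zero e]
    by (intro power_mono) (auto simp: exp_minus inverse_eq_divide intro!: divide_left_mono)
  also have "\<dots> = exp (- (real (d - 1) * (w / 4)))" by (simp flip: exp_of_nat_mult)
  also have "\<dots> \<le> exp (- L)"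
  proof -
    have "real d * L \<le> (2 * real (d - 1)) * L" using d L by (intro mult_right_mono) auto
    then have "L \<le> real (d - 1) * (w / 4)" using d by (simp add: w_def field_simps)
    then show ?thesis by simp
  qed
  finally show ?thesis .
qed

text \<open>A step with \<open>s = h \<rho>\<^sub>2\<close> below \<open>4 (ln (d \<kappa>) / d)\<^sup>1\<^sup>/\<^sup>3\<close> moves the slow coordinate too little; a longer
  step is accepted with probability at most \<open>1 / (d \<kappa>)\<close>.\<close>

lemma step_size_dichotomy:
  fixes s \<kappa> :: real and d :: nat
  defines "t \<equiv> (ln (real d * \<kappa>) / real d) powr (1 / 3)"
  assumes d: "3 \<le> d" and \<kappa>: "1 \<le> \<kappa>" and s: "0 < s" and t: "t \<le> 1 / 12"
  shows "2 * (s / \<kappa>) + (s / \<kappa>)\<^sup>2 \<le> 24 * (t / \<kappa>) \<or>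
    4 * (1 / sqrt (1 + s ^ 3 / 8)) ^ (d - 1) \<le> 24 * (t / \<kappa>)"
proof (cases "s \<le> 4 * t")
  case True
  define v where "v = s / \<kappa>"
  have v: "0 < v" "v \<le> 4 * (t / \<kappa>)" using s \<kappa> True by (auto simp: v_def divide_right_mono)
  \<comment> \<open>As s \<le> 4 t \<le> 1 / 3, the number v is at most 1, and 2 v + v^2 is at most
    3 v, that is at most 12 t / \<kappa>.\<close>
  have "v \<le> s" using s \<kappa> by (simp add: v_def divide_le_eq)
  then have "v \<le> 1" using True t by simp
  then have "v\<^sup>2 \<le> v" using v by (simp add: power2_eq_square mult_left_le)
  then have "2 * v + v\<^sup>2 \<le> 24 * (t / \<kappa>)" using v by simp
  then show ?thesis by (simp add: v_def)
next
  case False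
  define L where "L = ln (real d * \<kappa>)"
  \<comment> \<open>Here \<open>3 \<le> d\<close> enters: d \<kappa> is at least e, so that the
    logarithm \<open>L\<close> is at least 1.\<close>
  have "exp 1 \<le> (3 :: real)" by (rule exp_le)
  also have "\<dots> \<le> real d * \<kappa>" using d \<kappa> mult_mono[of 3 "real d" 1 \<kappa>] by simp
  finally have dk: "exp 1 \<le> real d * \<kappa>" .
  then have L1: "1 \<le> L" unfolding L_def using d \<kappa> by (subst ln_ge_iff) auto
  have t3: "t ^ 3 = L / real d"
    using L1 d unfolding t_def L_def[symmetric] by (simp add: powr_power)
  have t0: "0 < t" using L1 d unfolding t_def L_def[symmetric] by simp
  \<comment> \<open>The threshold 4 t is chosen so that its cube is 64 L / d, as
    \<open>affinity_power_bound\<close> requires.\<close>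
  have "(4 * t) ^ 3 \<le> s ^ 3" using False t0 by (intro power_mono) auto
  then have "64 * L / real d \<le> s ^ 3" by (simp add: power_mult_distrib t3)
  moreover have "t ^ 3 \<le> (1 / 12) ^ 3" using t t0 by (intro power_mono) auto
  then have "8 * L \<le> real d" using d L1 by (simp add: t3 power_divide field_simps)
  ultimately have "(1 / sqrt (1 + s ^ 3 / 8)) ^ (d - 1) \<le> exp (- L)"
    using d L1 by (intro affinity_power_bound) auto
  also have "\<dots> = 1 / (real d * \<kappa>)"
    using d \<kappa> by (simp add: L_def exp_minus inverse_eq_divide)
  also have "\<dots> \<le> t / \<kappa>"
  proof -
    \<comment> \<open>1 / d is at most its cube root, and \<open>1 \<le> L\<close> puts that root
      below \<open>t\<close>.\<close>
    have "(1 / real d) powr 1 \<le> (1 / real d) powr (1 / 3)"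
      using d by (intro powr_mono') auto
    also have "\<dots> \<le> t"
      unfolding t_def L_def[symmetric] using L1 d by (intro powr_mono2) (auto intro: divide_right_mono)
    finally have "1 / real d / \<kappa> \<le> t / \<kappa>"
      using d \<kappa> by (intro divide_right_mono) auto
    then show ?thesis by simp
  qed
  finally have "(1 / sqrt (1 + s ^ 3 / 8)) ^ (d - 1) \<le> t / \<kappa>" .
  moreover have "0 \<le> t / \<kappa>" using t0 \<kappa> by simp
  ultimately show ?thesis by linarith
qed

text \<open>Polynomial growth of \<kappa> keeps ln (d \<kappa>) below ln \<open>c\<^sub>1\<close> +
  (\<open>c\<^sub>2\<close> + 1) ln d, which is of smaller order than d. The estimate is uniform in
  \<kappa>, so \<open>N\<close> depends on \<open>c\<^sub>1\<close>, \<open>c\<^sub>2\<close> and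
  \<delta> only.\<close>

lemma eventually_log_ratio_small:
  fixes c\<^sub>1 c\<^sub>2 \<delta> :: real
  assumes "0 < c\<^sub>1" "0 < \<delta>"
  shows "\<exists>N::nat. \<forall>d>N. 3 \<le> d \<and> (\<forall>\<kappa>. 1 \<le> \<kappa> \<longrightarrow> \<kappa> \<le> c\<^sub>1 * real d powr c\<^sub>2 \<longrightarrow>
    (ln (real d * \<kappa>) / real d) powr (1 / 3) \<le> \<delta>)"
proof -
  have "(\<lambda>d. ln c\<^sub>1 / real d + (c\<^sub>2 + 1) * (ln (real d) / real d)) \<longlonglongrightarrow> 0 + (c\<^sub>2 + 1) * 0"
    by (intro tendsto_add tendsto_mult tendsto_const lim_const_over_n lim_ln_over_n)
  then have "eventually (\<lambda>d. ln c\<^sub>1 / real d + (c\<^sub>2 + 1) * (ln (real d) / real d) < \<delta> ^ 3) sequentially"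
    using assms by (intro order_tendstoD(2)) auto
  then obtain N\<^sub>0 where N\<^sub>0: "\<And>d. d \<ge> N\<^sub>0 \<Longrightarrow> ln c\<^sub>1 / real d + (c\<^sub>2 + 1) * (ln (real d) / real d) < \<delta> ^ 3"
    by (auto simp: eventually_sequentially)
  show ?thesis
  proof (intro exI[of _ "max N\<^sub>0 3"] allI impI conjI)
    fix d :: nat and \<kappa> :: real assume d: "max N\<^sub>0 3 < d" and \<kappa>: "1 \<le> \<kappa>" "\<kappa> \<le> c\<^sub>1 * real d powr c\<^sub>2"
    have "ln (real d * \<kappa>) \<le> ln (real d * (c\<^sub>1 * real d powr c\<^sub>2))"
      using d \<kappa> assms by (subst ln_le_cancel_iff) auto
    also have "\<dots> = ln c\<^sub>1 + (c\<^sub>2 + 1) * ln (real d)"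
      using d assms by (simp add: ln_mult ln_powr algebra_simps)
    finally have "ln (real d * \<kappa>) / real d \<le> ln c\<^sub>1 / real d + (c\<^sub>2 + 1) * (ln (real d) / real d)"
      using d by (simp add: divide_right_mono flip: add_divide_distrib)
    also have "\<dots> \<le> \<delta> ^ 3" using N\<^sub>0[of d] d by simp
    finally have le: "ln (real d * \<kappa>) / real d \<le> \<delta> ^ 3" .
    have "1 \<le> real d * \<kappa>" using d \<kappa> mult_mono[of 1 "real d" 1 \<kappa>] by simp
    then have "0 \<le> ln (real d * \<kappa>) / real d" by simp
    then have "(ln (real d * \<kappa>) / real d) powr (1 / 3) \<le> (\<delta> ^ 3) powr (1 / 3)"
      using le by (intro powr_mono2) auto
    also have "\<dots> = \<delta>" using assms by (simp add: powr_powr flip: powr_numeral)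
    finally show "(ln (real d * \<kappa>) / real d) powr (1 / 3) \<le> \<delta>" .
  qed auto
qed

text \<open>The constants \<open>c\<^sub>3\<close> and \<open>c\<^sub>4\<close> are chosen before
  \<open>c\<^sub>1\<close> and \<open>c\<^sub>2\<close>, hence are universal, while \<open>N\<close>
  comes after these two. For \<epsilon> \<ge> \<open>c\<^sub>4\<close> the logarithm is not positive
  and the bound is trivial.\<close>

theorem theorem3:
  shows "\<exists>c\<^sub>3 > (0::real). \<exists>c\<^sub>4 > (0::real). \<forall>c\<^sub>1 > (0::real). \<forall>c\<^sub>2 > (0::real). \<exists>N::nat. \<forall>d > N.
    \<forall>(I :: real mat) (S :: real mat) (J :: real mat) (\<rho>\<^sub>1::real) (\<rho>\<^sub>2::real) (\<kappa>::real)
      (M\<^sub>0::real) (h::real) (\<epsilon>::real).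
      spd_mat d I \<longrightarrow> spd_sqrt d I S \<longrightarrow> spd_mat d J \<longrightarrow>
      S * J * S = mat_diag d (\<lambda>i. if i = d - 1 then \<rho>\<^sub>1 else \<rho>\<^sub>2) \<longrightarrow>
      \<kappa> = \<rho>\<^sub>2 / \<rho>\<^sub>1 \<longrightarrow> 1 \<le> \<kappa> \<longrightarrow> \<kappa> \<le> c\<^sub>1 * real d powr c\<^sub>2 \<longrightarrow>
      2 \<le> M\<^sub>0 \<longrightarrow> 0 < h \<longrightarrow> 0 < \<epsilon> \<longrightarrow> \<epsilon> < 1 \<longrightarrow>
      ereal (c\<^sub>3 * \<kappa> * (real d / ln (real d * \<kappa>)) powr (1 / 3) * ln (c\<^sub>4 / \<epsilon>))
        \<le> ereal_of_enat (mix_time (1 / 2) d I J h \<epsilon> M\<^sub>0)"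
proof (rule exI[of _ "clamp_variance / 12"], rule conjI, simp add: clamp_variance_pos,
    rule exI[of _ "sqrt clamp_variance"], rule conjI, simp add: clamp_variance_pos, intro allI impI)
  fix c\<^sub>1 c\<^sub>2 :: real
  assume c: "0 < c\<^sub>1" "0 < c\<^sub>2"
  let ?cv = clamp_variance
  have cv: "0 < ?cv" "?cv \<le> 1" by (rule clamp_variance_pos clamp_variance_le_1)+
  obtain N :: nat where N: "\<And>d. d > N \<Longrightarrow> 3 \<le> d"
    "\<And>d \<kappa>. d > N \<Longrightarrow> 1 \<le> \<kappa> \<Longrightarrow> \<kappa> \<le> c\<^sub>1 * real d powr c\<^sub>2 \<Longrightarrow> (ln (real d * \<kappa>) / real d) powr (1 / 3) \<le> ?cv / 12"
    using eventually_log_ratio_small[OF c(1), of "?cv / 12" c\<^sub>2] cv by fastforce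
  show "\<exists>N::nat. \<forall>d > N.
    \<forall>(I :: real mat) (S :: real mat) (J :: real mat) (\<rho>\<^sub>1::real) (\<rho>\<^sub>2::real) (\<kappa>::real)
      (M\<^sub>0::real) (h::real) (\<epsilon>::real).
      spd_mat d I \<longrightarrow> spd_sqrt d I S \<longrightarrow> spd_mat d J \<longrightarrow>
      S * J * S = mat_diag d (\<lambda>i. if i = d - 1 then \<rho>\<^sub>1 else \<rho>\<^sub>2) \<longrightarrow>
      \<kappa> = \<rho>\<^sub>2 / \<rho>\<^sub>1 \<longrightarrow> 1 \<le> \<kappa> \<longrightarrow> \<kappa> \<le> c\<^sub>1 * real d powr c\<^sub>2 \<longrightarrow>
      2 \<le> M\<^sub>0 \<longrightarrow> 0 < h \<longrightarrow> 0 < \<epsilon> \<longrightarrow> \<epsilon> < 1 \<longrightarrow>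
      ereal (?cv / 12 * \<kappa> * (real d / ln (real d * \<kappa>)) powr (1 / 3) * ln (sqrt ?cv / \<epsilon>))
        \<le> ereal_of_enat (mix_time (1 / 2) d I J h \<epsilon> M\<^sub>0)"
  proof (rule exI[of _ N], intro allI impI)
    fix d :: nat and I S J :: "real mat" and \<rho>\<^sub>1 \<rho>\<^sub>2 \<kappa> M\<^sub>0 h \<epsilon> :: real
    assume d: "N < d" and IS: "spd_mat d I" "spd_sqrt d I S" and J: "spd_mat d J"
      and diag: "S * J * S = mat_diag d (\<lambda>i. if i = d - 1 then \<rho>\<^sub>1 else \<rho>\<^sub>2)"
      and \<kappa>: "\<kappa> = \<rho>\<^sub>2 / \<rho>\<^sub>1" "1 \<le> \<kappa>" "\<kappa> \<le> c\<^sub>1 * real d powr c\<^sub>2"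
      and M\<^sub>0: "2 \<le> M\<^sub>0" and h: "0 < h" and \<epsilon>: "0 < \<epsilon>" "\<epsilon> < 1"
    let ?l = "\<lambda>i. if i = d - 1 then \<rho>\<^sub>1 else \<rho>\<^sub>2"
    interpret gaussian_mala d I S J ?l h
      by standard (fact IS J diag h)+
    have d3: "3 \<le> d" and d0: "0 < d" using N(1)[OF d] by auto
    \<comment> \<open>The indices 0 and \<open>d - 1\<close> differ, so both diagonal values occur
      and are positive.\<close>
    have \<rho>: "0 < \<rho>\<^sub>1" "0 < \<rho>\<^sub>2" using l_pos[of "d - 1"] l_pos[of 0] d3 by auto
    define s where "s = h * \<rho>\<^sub>2"
    define t where "t = (ln (real d * \<kappa>) / real d) powr (1 / 3)"
    \<comment> \<open>Chosen so that 4 G times the variance is the bound 24 t / \<kappa> on the pair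
      form. Then 1 / (2 G) equals the variance times \<kappa> / (12 t), whence the 12 in
      \<open>c\<^sub>3\<close>.\<close>
    define G where "G = 6 * (t / \<kappa>) / ?cv"
    have s: "0 < s" "h * \<rho>\<^sub>1 = s / \<kappa>" using h \<rho> by (auto simp: s_def \<kappa>(1))
    have dk: "1 < real d * \<kappa>" using d3 \<kappa>(2) mult_mono[of 3 "real d" 1 \<kappa>] by simp
    have t: "0 < t" "t \<le> ?cv / 12"
      using dk d0 N(2)[OF d \<kappa>(2,3)] by (auto simp: t_def)
    have G: "0 < G" "G \<le> 1 / 2"
    proof -
      show "0 < G" using t cv \<kappa>(2) by (simp add: G_def)
      have "t / \<kappa> \<le> t" using t \<kappa>(2) by (simp add: divide_le_eq)
      then have "6 * (t / \<kappa>) \<le> 1 / 2 * ?cv" using t by linarith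
      then show "G \<le> 1 / 2" unfolding G_def by (simp only: pos_divide_le_eq[OF cv(1)])
    qed
    have slow: "mh.pair_form (\<lambda>z. (test (fst z) - test (snd z))\<^sup>2) \<le> 2 * (s / \<kappa>) + (s / \<kappa>)\<^sup>2"
      using pair_form_jump_bound[OF d0] by (simp add: s)
    \<comment> \<open>The slow coordinate contributes a factor at most 1, which is dropped; the
      \<open>d - 1\<close> equal fast factors remain.\<close>
    have "(\<Prod>i<d. 1 / sqrt (1 + (h * ?l i) ^ 3 / 8)) \<le> (1 / sqrt (1 + s ^ 3 / 8)) ^ (d - 1)"
    proof -
      obtain n where n: "d = Suc n" using d0 by (cases d) auto
      have "(\<Prod>i<n. 1 / sqrt (1 + (h * ?l i) ^ 3 / 8)) = (\<Prod>i<n. 1 / sqrt (1 + s ^ 3 / 8))"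
        by (intro prod.cong) (auto simp: n s_def)
      then have "(\<Prod>i<d. 1 / sqrt (1 + (h * ?l i) ^ 3 / 8)) =
          (1 / sqrt (1 + s ^ 3 / 8)) ^ n * (1 / sqrt (1 + (h * \<rho>\<^sub>1) ^ 3 / 8))"
        by (simp only: n prod.lessThan_Suc) simp
      also have "\<dots> \<le> (1 / sqrt (1 + s ^ 3 / 8)) ^ n"
      proof (rule mult_left_le)
        have le: "1 / y \<le> 1" if "1 \<le> y" for y :: real using that by simp
        have "0 \<le> (h * \<rho>\<^sub>1) ^ 3" using h \<rho> by (intro zero_le_power mult_nonneg_nonneg) auto
        then show "1 / sqrt (1 + (h * \<rho>\<^sub>1) ^ 3 / 8) \<le> 1" by (intro le) simp
      qed (use s(1) in simp)
      finally show ?thesis by (simp add: n)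
    qed
    then have fast: "mh.pair_form (\<lambda>z. (test (fst z) - test (snd z))\<^sup>2) \<le> 4 * (1 / sqrt (1 + s ^ 3 / 8)) ^ (d - 1)"
      using pair_form_affinity_bound[OF d0] by linarith
    have "mh.pair_form (\<lambda>z. (test (fst z) - test (snd z))\<^sup>2) \<le> 24 * (t / \<kappa>)"
      using step_size_dichotomy[OF d3 \<kappa>(2) s(1)] t cv slow fast unfolding t_def by linarith
    then have gap: "mh.pair_form (\<lambda>z. (test (fst z) - test (snd z))\<^sup>2) \<le> 4 * G * ?cv"
      using cv by (simp add: G_def)
    have "(real d / ln (real d * \<kappa>)) powr (1 / 3) = 1 / t"
      using dk d0 by (simp add: t_def powr_divide)
    then have eq: "?cv / 12 * \<kappa> * (real d / ln (real d * \<kappa>)) powr (1 / 3) * ln (sqrt ?cv / \<epsilon>) = ln (sqrt ?cv / \<epsilon>) / (2 * G)"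
      using cv \<kappa>(2) by (simp add: G_def)
    show "ereal (?cv / 12 * \<kappa> * (real d / ln (real d * \<kappa>)) powr (1 / 3) * ln (sqrt ?cv / \<epsilon>))
        \<le> ereal_of_enat (mix_time (1 / 2) d I J h \<epsilon> M\<^sub>0)"
      unfolding eq
    proof (rule mix_time_lower_bound[OF d0 gap])
      show "G \<le> 1" using G by simp
      show "ln (sqrt ?cv / \<epsilon>) / (2 * G) \<le> real k" if "(1 - G) ^ (2 * k) * ?cv \<le> \<epsilon>\<^sup>2" for k
        by (rule decay_time_lower_bound[OF G cv(1) \<epsilon>(1) that])
    qed fact+
  qed
qed

end
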